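(* Let $(\mathfrak{g},\mu)$ be a finite-dimensional real Lie algebra. If $H^3(\mathfrak{g},\mathfrak{g})=0$, then the space of Lie algebra structures on the vector space $\mathfrak{g}$ (as a subset of $\mathrm{Hom}(\wedge^2\mathfrak{g},\mathfrak{g})$) is, in a neighborhood of $\mu$, a smooth manifold of dimension equal to $\dim Z^2(\mathfrak{g},\mathfrak{g})$.
   Context: The Chevalley–Eilenberg complex of $(\mathfrak{g},\mu)$ with coefficients in the adjoint representation has cochains $C^k(\mathfrak{g},\mathfrak{g})=\mathrm{Hom}(\wedge^k\mathfrak{g},\mathfrak{g})$; its differential is denoted $\delta_\mu$, $Z^2(\mathfrak{g},\mathfrak{g})=\ker(\delta_\mu:C^2(\mathfrak{g},\mathfrak{g})\to C^3(\mathfrak{g},\mathfrak{g}))$, and $H^3(\mathfrak{g},\mathfrak{g})$ is its degree-three cohomology. The space of Lie algebra structures on $\mathfrak{g}$ is the set of all skew-symmetric bilinear maps $\mathfrak{g}\times\mathfrak{g}\to\mathfrak{g}$ satisfying the Jacobi identity. The manifold statement means that there is an open neighborhood of $\mu$ in $\mathrm{Hom}(\wedge^2\mathfrak{g},\mathfrak{g})$ whose intersection with this set is a smooth submanifold of the stated dimension. *)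

theory Defs
  imports "HOL-Analysis.Analysis" "HOL-Library.Function_Algebras"
begin

section \<open>The normed space of skew-symmetric bilinear maps\<close>

text \<open>On a finite-dimensional space every bilinear map is bounded, so for
  finite-dimensional \<open>'a\<close> this type is all of \<open>Hom(\<Lambda>\<^sup>2 'a, 'a)\<close>; the operator norm
  induces its unique Hausdorff vector space topology, whatever the norm on \<open>'a\<close>.\<close>

typedef (overloaded) 'a skew_bilinear =
  "{b :: 'a::real_normed_vector \<Rightarrow>\<^sub>L 'a \<Rightarrow>\<^sub>L 'a. \<forall>x y. b x y = - b y x}"
  morphisms blinfun_of_skew Abs_skew_bilinear
  by (rule exI[of _ 0]) simp

setup_lifting type_definition_skew_bilinear

instantiation skew_bilinear :: (real_normed_vector) real_normed_vector
begin

lift_definition norm_skew_bilinear :: "'a skew_bilinear \<Rightarrow> real" is norm .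

lift_definition minus_skew_bilinear ::
  "'a skew_bilinear \<Rightarrow> 'a skew_bilinear \<Rightarrow> 'a skew_bilinear" is "(-)"
  by (metis (no_types, opaque_lifting) blinfun.diff_left minus_diff_commute minus_diff_minus)

lift_definition plus_skew_bilinear ::
  "'a skew_bilinear \<Rightarrow> 'a skew_bilinear \<Rightarrow> 'a skew_bilinear" is "(+)"
  by (metis (no_types, opaque_lifting) blinfun.add_left minus_add_distrib)

lift_definition uminus_skew_bilinear :: "'a skew_bilinear \<Rightarrow> 'a skew_bilinear" is uminus
  by (metis (no_types, opaque_lifting) blinfun.minus_left)

lift_definition zero_skew_bilinear :: "'a skew_bilinear" is 0
  by simp

lift_definition scaleR_skew_bilinear :: "real \<Rightarrow> 'a skew_bilinear \<Rightarrow> 'a skew_bilinear"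
  is "\<lambda>r b. r *\<^sub>R b"
  by (metis (no_types, opaque_lifting) blinfun.scaleR_left scaleR_minus_right)

definition dist_skew_bilinear :: "'a skew_bilinear \<Rightarrow> 'a skew_bilinear \<Rightarrow> real"
  where "dist_skew_bilinear a b = norm (a - b)"

definition uniformity_skew_bilinear :: "('a skew_bilinear \<times> 'a skew_bilinear) filter"
  where "uniformity_skew_bilinear = (INF e\<in>{0 <..}. principal {(x, y). dist x y < e})"

definition open_skew_bilinear :: "'a skew_bilinear set \<Rightarrow> bool"
  where "open_skew_bilinear S = (\<forall>x\<in>S. \<forall>\<^sub>F (x', y) in uniformity. x' = x \<longrightarrow> y \<in> S)"

definition sgn_skew_bilinear :: "'a skew_bilinear \<Rightarrow> 'a skew_bilinear"
  where "sgn_skew_bilinear x = inverse (norm x) *\<^sub>R x"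

instance
  apply standard
  unfolding dist_skew_bilinear_def open_skew_bilinear_def sgn_skew_bilinear_def
    uniformity_skew_bilinear_def
  apply (rule refl | (transfer, simp add: algebra_simps norm_triangle_ineq))+
  done

end

definition skew_apply :: "'a::real_normed_vector skew_bilinear \<Rightarrow> 'a \<Rightarrow> 'a \<Rightarrow> 'a" where
  "skew_apply b x y = blinfun_of_skew b x y"

definition lie_structures :: "'a::real_normed_vector skew_bilinear set" where
  "lie_structures = {b. \<forall>x y z.
     skew_apply b x (skew_apply b y z) + skew_apply b y (skew_apply b z x)
       + skew_apply b z (skew_apply b x y) = 0}"


section \<open>The Chevalley--Eilenberg complex with adjoint coefficients\<close>

instantiation "fun" :: (type, real_vector) real_vector
begin

definition scaleR_fun :: "real \<Rightarrow> ('a \<Rightarrow> 'b) \<Rightarrow> 'a \<Rightarrow> 'b" where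
  "scaleR_fun r f = (\<lambda>x. r *\<^sub>R f x)"

instance
  by standard (auto simp: scaleR_fun_def fun_eq_iff algebra_simps)

end

text \<open>A \<open>k\<close>-cochain takes its arguments as a list of length \<open>k\<close>; the value on lists
  of any other length is fixed to \<open>0\<close>, so that a cochain is determined by its
  values on \<open>k\<close>-tuples.\<close>

definition cochains :: "nat \<Rightarrow> ('a::real_vector list \<Rightarrow> 'a) set" where
  "cochains k = {\<omega>.
     (\<forall>xs. length xs \<noteq> k \<longrightarrow> \<omega> xs = 0) \<and>
     (\<forall>xs i. length xs = k \<and> i < k \<longrightarrow> linear (\<lambda>v. \<omega> (xs[i := v]))) \<and>
     (\<forall>xs i j. length xs = k \<and> i < j \<and> j < k \<and> xs ! i = xs ! j \<longrightarrow> \<omega> xs = 0)}"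

definition omit :: "nat \<Rightarrow> 'a list \<Rightarrow> 'a list" where
  "omit i xs = take i xs @ drop (Suc i) xs"

text \<open>Arguments are numbered from \<open>0\<close>; this fixes the sign conventions.\<close>

definition ce_diff ::
  "('a::real_vector \<Rightarrow> 'a \<Rightarrow> 'a) \<Rightarrow> nat \<Rightarrow> ('a list \<Rightarrow> 'a) \<Rightarrow> 'a list \<Rightarrow> 'a" where
  "ce_diff m k \<omega> xs =
     (if length xs = Suc k then
        (\<Sum>i\<le>k. (- 1) ^ i *\<^sub>R m (xs ! i) (\<omega> (omit i xs)))
        + (\<Sum>j\<le>k. \<Sum>i<j. (- 1) ^ (i + j) *\<^sub>R
             \<omega> (m (xs ! i) (xs ! j) # omit i (omit j xs)))
      else 0)"

definition cocycles ::
  "('a::real_vector \<Rightarrow> 'a \<Rightarrow> 'a) \<Rightarrow> nat \<Rightarrow> ('a list \<Rightarrow> 'a) set" where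
  "cocycles m k = {\<omega> \<in> cochains k. ce_diff m k \<omega> = 0}"

definition coboundaries ::
  "('a::real_vector \<Rightarrow> 'a \<Rightarrow> 'a) \<Rightarrow> nat \<Rightarrow> ('a list \<Rightarrow> 'a) set" where
  "coboundaries m k = (case k of 0 \<Rightarrow> {0} | Suc l \<Rightarrow> ce_diff m l ` cochains l)"

text \<open>The underlying set of the quotient space; its zero is the class \<open>coboundaries m k\<close>.\<close>

definition cohomology ::
  "('a::real_vector \<Rightarrow> 'a \<Rightarrow> 'a) \<Rightarrow> nat \<Rightarrow> ('a list \<Rightarrow> 'a) set set" where
  "cohomology m k = cocycles m k // {(\<omega>, \<eta>). \<omega> - \<eta> \<in> coboundaries m k}"


section \<open>Smooth submanifolds\<close>

text \<open>For an open subset \<open>S\<close> of a finite-dimensional space, \<open>Ck_on k S f\<close> says that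
  \<open>f\<close> is of class \<open>C\<^sup>k\<close> on \<open>S\<close>: all iterated directional derivatives up to order \<open>k\<close>
  exist and are continuous.\<close>

primrec Ck_on ::
  "nat \<Rightarrow> 'v::real_normed_vector set \<Rightarrow> ('v \<Rightarrow> 'w::real_normed_vector) \<Rightarrow> bool" where
  "Ck_on 0 S f \<longleftrightarrow> continuous_on S f"
| "Ck_on (Suc k) S f \<longleftrightarrow>
     (\<forall>x\<in>S. f differentiable (at x)) \<and>
     (\<forall>v. Ck_on k S (\<lambda>x. frechet_derivative f (at x) v))"

definition smooth_on ::
  "'v::real_normed_vector set \<Rightarrow> ('v \<Rightarrow> 'w::real_normed_vector) \<Rightarrow> bool" where
  "smooth_on S f \<longleftrightarrow> (\<forall>k. Ck_on k S f)"

text \<open>Embedded \<open>d\<close>-dimensional submanifolds of a finite-dimensional space, by slice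
  charts: near each of its points the set is straightened to a \<open>d\<close>-dimensional linear
  subspace by a diffeomorphism between open sets of the ambient space.\<close>

definition smooth_submanifold :: "nat \<Rightarrow> 'v::real_normed_vector set \<Rightarrow> bool" where
  "smooth_submanifold d M \<longleftrightarrow>
     (\<forall>p\<in>M. \<exists>U W (\<phi> :: 'v \<Rightarrow> 'v) \<psi> B.
        open U \<and> p \<in> U \<and> open W \<and>
        homeomorphism U W \<phi> \<psi> \<and> smooth_on U \<phi> \<and> smooth_on W \<psi> \<and>
        finite B \<and> independent B \<and> card B = d \<and>
        \<phi> ` (U \<inter> M) = W \<inter> span B)"

end

theory Submission
  imports Defs
begin

text \<open>Write \<open>\<delta>\<close> for the differential of \<open>\<mu>\<close>, \<open>J(b)\<close> for the Jacobiator of \<open>b\<close>, and let the linear map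
  \<open>\<sigma> : C\<^sup>3 \<rightarrow> C\<^sup>2\<close> satisfy \<open>\<delta> \<sigma> \<delta> = \<delta>\<close> on \<open>C\<^sup>2\<close>. Since \<open>J(\<mu> + a) = \<delta> a + J(a)\<close>, the Kuranishi map
  \<open>\<phi>(\<mu> + a) = a + \<sigma> J(a)\<close> satisfies \<open>\<delta> \<phi>(b) = \<delta> \<sigma> J(b)\<close>, so it sends \<open>b\<close> into \<open>Z\<^sup>2\<close> iff the
  component \<open>\<delta> \<sigma> J(b)\<close> of \<open>J(b)\<close> in the coboundaries vanishes. Because \<open>H\<^sup>3 = 0\<close>, near \<open>\<mu>\<close> the graded
  Jacobi identity \<open>\<delta>\<^sub>b J(b) = 0\<close> then forces \<open>J(b) = 0\<close>. As \<open>\<phi>\<close> is the identity plus a quadratic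
  map, it is a local diffeomorphism at \<open>\<mu>\<close>, and hence a slice chart for the Lie algebra structures.\<close>

section \<open>Finite-dimensional normed spaces\<close>

text \<open>In coordinates the unit sphere of the maximum norm is compact, and by independence the
  linear combination map has no zero on it. Its image therefore keeps a distance \<open>d\<close>
  from 0, and scaling gives the bound with \<open>1 / d\<close>.\<close>

lemma representation_bounded:
  fixes B :: "'a::real_normed_vector set"
  assumes fin: "finite B" and ind: "independent B" and span: "span B = UNIV"
  obtains K where "K > 0" "\<And>x b. \<bar>representation B x b\<bar> \<le> K * norm x"
proof -
  \<comment> \<open>\<open>box b s\<close> is the face of the coefficient cube on which coordinate
    \<open>b\<close> equals \<open>s\<close>. Coefficients off \<open>B\<close> are pinned to 0, so
    that Tychonoff's theorem applies to functions on the whole type; \<open>S\<close> becomes the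
    unit sphere.\<close>
  define box where "box b s = Pi\<^sub>E UNIV (\<lambda>c. if c = b then {s} else if c \<in> B then {-1..1} else {0::real})"
    for b s
  define f where "f x = (\<Sum>b\<in>B. x b *\<^sub>R b)" for x :: "'a \<Rightarrow> real"
  define S where "S = (\<Union>b\<in>B. \<Union>s\<in>{-1, 1}. box b s)"
  have "compact (box b s)" for b s
  proof -
    have "compactin (product_topology (\<lambda>_. euclidean) UNIV) (box b s)"
      unfolding box_def compactin_PiE by (auto simp: compactin_euclidean_iff)
    then show ?thesis
      by (simp add: euclidean_product_topology compactin_euclidean_iff)
  qed
  then have "compact S"
    unfolding S_def using fin by (intro compact_UN) auto
  moreover have "continuous_on S f"
  proof -
    have "continuous_on UNIV f"
      unfolding f_def by (intro continuous_intros) auto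
    then show ?thesis
      using continuous_on_subset by blast
  qed
  ultimately have "closed (f ` S)"
    by (simp add: compact_continuous_image compact_imp_closed)
  moreover have "0 \<notin> f ` S"
  proof
    assume "0 \<in> f ` S"
    then obtain b s x where x: "b \<in> B" "s \<in> {-1, 1}" "x \<in> box b s" "f x = 0"
      unfolding S_def by (elim imageE UN_E) auto
    then have "x b = s"
      by (auto simp: box_def PiE_iff split: if_splits)
    moreover have "x b = 0"
      using independentD[OF ind fin subset_refl] x unfolding f_def by metis
    ultimately show False
      using x by auto
  qed
  ultimately obtain d where "d > 0" "ball 0 d \<subseteq> - (f ` S)"
    by (metis ComplI open_Compl open_contains_ball)
  then have d: "d > 0" "\<And>k. k \<in> f ` S \<Longrightarrow> d \<le> norm k"
    by (force simp: not_less[symmetric])+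
  have "\<bar>representation B x b\<bar> \<le> (1 / d) * norm x" for x b
  proof (cases "representation B x b = 0")
    case True
    then show ?thesis using d by simp
  next
    case False
    let ?r = "representation B x"
    define M where "M = Max ((\<lambda>c. \<bar>?r c\<bar>) ` B)"
    have bB: "b \<in> B"
      using False representation_ne_zero by blast
    have "M \<in> (\<lambda>c. \<bar>?r c\<bar>) ` B"
      unfolding M_def by (rule Max_in) (use fin bB in auto)
    then obtain c where c: "c \<in> B" "M = \<bar>?r c\<bar>"
      by auto
    have M: "\<bar>?r e\<bar> \<le> M" if "e \<in> B" for e
      unfolding M_def by (rule Max_ge) (use fin that in auto)
    then have Mpos: "M > 0"
      using M[OF bB] False by linarith
    \<comment> \<open>Dividing by the largest coordinate moves \<open>x\<close> onto the face
      belonging to \<open>c\<close> and its sign.\<close>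
    have "(\<lambda>e. ?r e / M) \<in> box c (sgn (?r c))"
      unfolding box_def
    proof (rule PiE_I)
      fix e
      have "?r e = 0" if "e \<notin> B"
        using that representation_ne_zero by blast
      moreover have "- 1 \<le> ?r e / M \<and> ?r e / M \<le> 1" if "e \<in> B"
        using M[OF that] Mpos by (simp add: field_simps abs_le_iff)
      moreover have "?r c / M = sgn (?r c)"
        using c(2) by (simp add: sgn_real_def)
      ultimately show "?r e / M \<in> (if e = c then {sgn (?r c)} else if e \<in> B then {-1..1} else {0})"
        by simp
    qed simp
    moreover have "sgn (?r c) \<in> {-1, 1}"
      using c Mpos by (auto simp: sgn_if)
    ultimately have "(\<lambda>e. ?r e / M) \<in> S"
      using c unfolding S_def by blast
    moreover have "f (\<lambda>e. ?r e / M) = x /\<^sub>R M"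
      using sum_representation_eq[OF ind _ fin subset_refl, of x] span
      by (simp add: f_def divide_inverse_commute flip: scaleR_scaleR scaleR_right.sum)
    ultimately have "d \<le> norm (x /\<^sub>R M)"
      using d(2) by (metis image_eqI)
    then have "d * M \<le> norm x"
      using Mpos by (simp add: field_simps)
    moreover have "d * \<bar>?r b\<bar> \<le> d * M"
      using M[OF bB] d(1) by simp
    ultimately have "d * \<bar>?r b\<bar> \<le> norm x"
      by linarith
    then show ?thesis
      using d(1) by (simp add: field_simps)
  qed
  then show ?thesis
    using that[of "1 / d"] d(1) by auto
qed

lemma finite_span_basis:
  fixes V :: "'a::real_vector set"
  assumes "finite F" "V \<subseteq> span F" "subspace V"
  obtains B where "finite B" "independent B" "span B = V" "card B = dim V"
proof -
  obtain B where B: "B \<subseteq> V" "independent B" "V \<subseteq> span B" "card B = dim V"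
    using basis_exists .
  moreover have "finite B"
    using independent_span_bound[OF assms(1) B(2)] B(1) assms(2) by auto
  moreover have "span B = V"
    using B assms(3) by (simp add: span_minimal subset_antisym)
  ultimately show ?thesis
    using that by blast
qed

lemma linear_imp_bounded_linear:
  fixes f :: "'a::real_normed_vector \<Rightarrow> 'b::real_normed_vector"
  assumes fd: "\<exists>B :: 'a set. finite B \<and> span B = UNIV" and lin: "linear f"
  shows "bounded_linear f"
proof -
  obtain B :: "'a set" where B: "finite B" "independent B" "span B = UNIV"
    using fd finite_span_basis[of _ UNIV] by (metis subspace_UNIV top_greatest)
  obtain K where K: "K > 0" "\<And>x b. \<bar>representation B x b\<bar> \<le> K * norm x"
    using representation_bounded[OF B] by blast
  have "norm (f x) \<le> norm x * (\<Sum>b\<in>B. K * norm (f b))" for x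
  proof -
    have "f x = f (\<Sum>b\<in>B. representation B x b *\<^sub>R b)"
      using sum_representation_eq[OF B(2) _ B(1)] B(3) by simp
    also have "norm \<dots> \<le> (\<Sum>b\<in>B. norm (representation B x b *\<^sub>R f b))"
      by (simp add: linear_sum[OF lin] linear_cmul[OF lin] sum_norm_le)
    also have "\<dots> \<le> (\<Sum>b\<in>B. K * norm x * norm (f b))"
      by (intro sum_mono) (simp add: K mult_right_mono)
    finally show ?thesis
      by (simp add: sum_distrib_left mult_ac)
  qed
  then show ?thesis
    using lin by (intro bounded_linear_intro) (auto simp: linear_add linear_cmul)
qed

text \<open>Only the first argument is expanded in a basis: each of the finitely many linear maps
  \<open>f b\<close> is already bounded.\<close>

lemma bilinear_imp_bounded_bilinear:
  fixes f :: "'a::real_normed_vector \<Rightarrow> 'b::real_normed_vector \<Rightarrow> 'c::real_normed_vector"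
  assumes fa: "\<exists>B :: 'a set. finite B \<and> span B = UNIV"
    and fb: "\<exists>B :: 'b set. finite B \<and> span B = UNIV"
    and bil: "bilinear f"
  shows "bounded_bilinear f"
proof -
  obtain B :: "'a set" where B: "finite B" "independent B" "span B = UNIV"
    using fa finite_span_basis[of _ UNIV] by (metis subspace_UNIV top_greatest)
  obtain K where K: "K > 0" "\<And>x b. \<bar>representation B x b\<bar> \<le> K * norm x"
    using representation_bounded[OF B] by blast
  have lin1: "linear (\<lambda>x. f x y)" and lin2: "linear (f x)" for x y
    using bil by (auto simp: bilinear_def)
  have "\<exists>L. \<forall>y. norm (f b y) \<le> L * norm y" for b
    using linear_imp_bounded_linear[OF fb lin2] bounded_linear.bounded[of "f b"]
    by (auto simp: mult_ac)
  then obtain L where L: "\<And>b y. norm (f b y) \<le> L b * norm y"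
    by metis
  have "norm (f x y) \<le> norm x * norm y * (\<Sum>b\<in>B. K * L b)" for x y
  proof -
    have "f x y = f (\<Sum>b\<in>B. representation B x b *\<^sub>R b) y"
      using sum_representation_eq[OF B(2) _ B(1)] B(3) by simp
    also have "norm \<dots> \<le> (\<Sum>b\<in>B. norm (representation B x b *\<^sub>R f b y))"
      by (simp add: linear_sum[OF lin1] linear_cmul[OF lin1] sum_norm_le)
    also have "\<dots> \<le> (\<Sum>b\<in>B. (K * norm x) * (L b * norm y))"
      using K(1) by (auto intro!: sum_mono mult_mono K(2) L)
    finally show ?thesis
      by (simp add: sum_distrib_left mult_ac)
  qed
  then show ?thesis
    using bil by (intro bounded_bilinear.intro exI)
      (auto simp: bilinear_ladd bilinear_radd bilinear_lmul bilinear_rmul)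
qed

text \<open>Coordinates are bounded linear, so they converge along a Cauchy sequence. Completeness
  is what the Banach fixed point theorem asks for later.\<close>

lemma finite_dim_complete_UNIV:
  assumes fd: "\<exists>B :: 'a::real_normed_vector set. finite B \<and> span B = UNIV"
  shows "complete (UNIV :: 'a set)"
proof (rule completeI)
  fix X :: "nat \<Rightarrow> 'a" assume "Cauchy X"
  obtain B :: "'a set" where B: "finite B" "independent B" "span B = UNIV"
    using fd finite_span_basis[of _ UNIV] by (metis subspace_UNIV top_greatest)
  have "\<exists>l. (\<lambda>n. representation B (X n) b) \<longlonglongrightarrow> l" for b
  proof -
    have "linear (\<lambda>x. representation B x b)"
      using B by (intro linearI) (simp_all add: representation_add representation_scale)
    then have "bounded_linear (\<lambda>x. representation B x b)"
      by (rule linear_imp_bounded_linear[OF fd])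
    then have "Cauchy (\<lambda>n. representation B (X n) b)"
      using \<open>Cauchy X\<close> by (rule bounded_linear.Cauchy)
    then show ?thesis
      by (simp add: Cauchy_convergent_iff convergent_def)
  qed
  then obtain l where "\<And>b. (\<lambda>n. representation B (X n) b) \<longlonglongrightarrow> l b"
    by metis
  then have "(\<lambda>n. \<Sum>b\<in>B. representation B (X n) b *\<^sub>R b) \<longlonglongrightarrow> (\<Sum>b\<in>B. l b *\<^sub>R b)"
    by (intro tendsto_intros)
  then show "\<exists>l\<in>UNIV. X \<longlonglongrightarrow> l"
    using sum_representation_eq[OF B(2) _ B(1) subset_refl] B(3) by auto
qed

text \<open>The space of \<open>w\<close> carries no norm; the sum of the absolute coordinates along
  \<open>F\<close> replaces it. In that norm a fixed point satisfies
  \<open>n \<le> n * (norm a * K)\<close>, which forces \<open>n = 0\<close> for small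
  \<open>a\<close>.\<close>

lemma small_perturbation_no_fixed_point:
  fixes T :: "'v::real_normed_vector \<Rightarrow> 'w::real_vector \<Rightarrow> 'w"
  assumes fd: "\<exists>B :: 'v set. finite B \<and> span B = UNIV"
    and fin: "finite F" and ind: "independent F"
    and lin: "\<And>a. linear (T a)" and lin': "\<And>w. w \<in> span F \<Longrightarrow> linear (\<lambda>a. T a w)"
  obtains e where "e > 0"
    "\<And>a w. norm a < e \<Longrightarrow> w \<in> span F \<Longrightarrow> T a w = w \<Longrightarrow> w = 0"
proof -
  \<comment> \<open>\<open>T a\<close> may leave \<open>span F\<close>, so coordinates are taken in
    a basis of the whole space that extends \<open>F\<close>.\<close>
  define E where "E = extend_basis F"
  have E: "F \<subseteq> E" "independent E" "span E = UNIV"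
    unfolding E_def using ind by (auto simp: extend_basis_superset independent_extend_basis)
  define r where "r = representation E"
  have r_lin: "linear (\<lambda>w. r w c)" for c
    unfolding r_def using E by (intro linearI) (simp_all add: representation_add representation_scale)
  have w_eq: "(\<Sum>b\<in>F. r w b *\<^sub>R b) = w" if "w \<in> span F" for w
    using that sum_representation_eq[OF ind that fin] representation_extend[OF E(2) that E(1)]
    by (simp add: r_def)
  have "\<exists>L. \<forall>a. \<bar>r (T a b) c\<bar> \<le> L * norm a" if "b \<in> F" for b c
  proof -
    have "linear (\<lambda>a. r (T a b) c)"
      using linear_compose[OF lin' r_lin, of b c] that by (simp add: span_base o_def)
    then show ?thesis
      using linear_imp_bounded_linear[OF fd, of "\<lambda>a. r (T a b) c"]
        bounded_linear.bounded[of "\<lambda>a. r (T a b) c"] by (auto simp: mult_ac)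
  qed
  then obtain L where L: "\<And>a b c. b \<in> F \<Longrightarrow> \<bar>r (T a b) c\<bar> \<le> L b c * norm a"
    by metis
  \<comment> \<open>The summand 1 keeps \<open>K\<close> positive, so that \<open>1 / K\<close> can
    serve as the radius.\<close>
  define K where "K = 1 + (\<Sum>c\<in>F. \<Sum>b\<in>F. \<bar>L b c\<bar>)"
  have K: "K > 0"
    unfolding K_def by (intro add_pos_nonneg sum_nonneg) auto
  have LK: "(\<Sum>c\<in>F. \<bar>L b c\<bar>) \<le> K" if "b \<in> F" for b
  proof -
    have "(\<Sum>c\<in>F. \<bar>L b c\<bar>) \<le> (\<Sum>c\<in>F. \<Sum>b\<in>F. \<bar>L b c\<bar>)"
      using fin that by (intro sum_mono member_le_sum) auto
    then show ?thesis
      by (simp add: K_def)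
  qed
  have "w = 0" if a: "norm a < 1 / K" and w: "w \<in> span F" "T a w = w" for a w
  proof -
    define n where "n = (\<Sum>b\<in>F. \<bar>r w b\<bar>)"
    have r_w: "r w c = (\<Sum>b\<in>F. r w b * r (T a b) c)" for c
    proof -
      have "r w c = r (T a (\<Sum>b\<in>F. r w b *\<^sub>R b)) c"
        using w w_eq by simp
      also have "\<dots> = (\<Sum>b\<in>F. r w b * r (T a b) c)"
        by (simp add: linear_sum[OF lin] linear_cmul[OF lin] linear_sum[OF r_lin] linear_cmul[OF r_lin])
      finally show ?thesis .
    qed
    have "n = (\<Sum>c\<in>F. \<bar>\<Sum>b\<in>F. r w b * r (T a b) c\<bar>)"
      unfolding n_def by (intro sum.cong refl arg_cong[of _ _ abs] r_w)
    also have "\<dots> \<le> (\<Sum>c\<in>F. \<Sum>b\<in>F. \<bar>r w b\<bar> * (\<bar>L b c\<bar> * norm a))"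
    proof (intro sum_mono order.trans[OF sum_abs])
      fix b c assume "b \<in> F"
      then have "\<bar>r (T a b) c\<bar> \<le> \<bar>L b c\<bar> * norm a"
        using L[of b a c] by (meson abs_ge_self mult_right_mono norm_ge_zero order.trans)
      then show "\<bar>r w b * r (T a b) c\<bar> \<le> \<bar>r w b\<bar> * (\<bar>L b c\<bar> * norm a)"
        by (simp add: abs_mult mult_left_mono)
    qed
    also have "\<dots> = (\<Sum>b\<in>F. (\<bar>r w b\<bar> * norm a) * (\<Sum>c\<in>F. \<bar>L b c\<bar>))"
      by (subst sum.swap) (simp add: sum_distrib_left mult_ac)
    also have "\<dots> \<le> (\<Sum>b\<in>F. (\<bar>r w b\<bar> * norm a) * K)"
      by (intro sum_mono mult_left_mono LK) auto
    also have "\<dots> = n * (norm a * K)"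
      by (simp add: n_def sum_distrib_left mult_ac)
    finally have "n \<le> n * (norm a * K)" .
    moreover have "norm a * K < 1"
      using a K by (simp add: field_simps)
    moreover have "n \<ge> 0"
      by (simp add: n_def sum_nonneg)
    ultimately have "n = 0"
      using mult_strict_left_mono[of "norm a * K" 1 n] by (cases "n = 0") auto
    then have "r w b = 0" if "b \<in> F" for b
      using that fin by (auto simp: n_def sum_nonneg_eq_0_iff)
    then show ?thesis
      using w_eq[OF w(1)] by simp
  qed
  then show ?thesis
    using that[of "1 / K"] K by auto
qed

section \<open>Quadratic perturbations of the identity\<close>

text \<open>On an open set the derivative depends only on the values in the set, so the induction
  passes to derivatives.\<close>

lemma Ck_on_cong:
  assumes "open S" "\<And>x. x \<in> S \<Longrightarrow> f x = g x" "Ck_on k S f"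
  shows "Ck_on k S g"
  using assms(2,3)
proof (induction k arbitrary: f g)
  case 0
  then show ?case
    by (metis Ck_on.simps(1) continuous_on_cong)
next
  case (Suc k)
  have D: "(g has_derivative frechet_derivative f (at x)) (at x)" if "x \<in> S" for x
  proof (rule has_derivative_transform_within_open[OF _ assms(1) that])
    show "(f has_derivative frechet_derivative f (at x)) (at x)"
      using Suc.prems that by (simp add: frechet_derivative_works)
  qed (use Suc.prems in auto)
  have "frechet_derivative f (at x) v = frechet_derivative g (at x) v" if "x \<in> S" for x v
    by (simp only: frechet_derivative_at[OF D[OF that]])
  moreover have "Ck_on k S (\<lambda>x. frechet_derivative f (at x) v)" for v
    using Suc.prems(2) by simp
  ultimately have "Ck_on k S (\<lambda>x. frechet_derivative g (at x) v)" for v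
    by (rule Suc.IH)
  then show ?case
    using D by (auto simp: differentiable_def)
qed

text \<open>A class of differentiable functions closed under directional derivatives consists of
  smooth functions. Smoothness proofs reduce to guessing such a class \<open>P\<close>.\<close>

lemma smooth_on_coinduct:
  assumes "open S" "P f"
    and step: "\<And>f. P f \<Longrightarrow> \<exists>D. (\<forall>x\<in>S. (f has_derivative D x) (at x)) \<and> (\<forall>v. P (\<lambda>x. D x v))"
  shows "smooth_on S f"
proof -
  have "Ck_on k S f" for k
    using \<open>P f\<close>
  proof (induction k arbitrary: f)
    case 0
    then obtain D where "\<forall>x\<in>S. (f has_derivative D x) (at x)"
      using step by blast
    then show ?case
      unfolding Ck_on.simps by (blast intro: continuous_at_imp_continuous_on has_derivative_continuous)
  next
    case (Suc k)
    then obtain D where D: "\<And>x. x \<in> S \<Longrightarrow> (f has_derivative D x) (at x)" "\<And>v. P (\<lambda>x. D x v)"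
      using step by metis
    have "Ck_on k S (\<lambda>x. frechet_derivative f (at x) v)" for v
      by (rule Ck_on_cong[OF assms(1) _ Suc.IH[OF D(2)]]) (simp only: frechet_derivative_at[OF D(1)])
    then show ?case
      using D(1) by (auto simp: differentiable_def)
  qed
  then show ?thesis
    by (simp add: smooth_on_def)
qed

text \<open>Setting for an inverse function theorem with explicit radius:
  \<open>4 * (K * r) \<le> 1\<close> makes the derivative of the quadratic part at most 1/2 in norm
  on the ball of radius \<open>r\<close>.\<close>

locale quadratic_perturbation =
  fixes \<beta> :: "'v::real_normed_vector \<Rightarrow> 'v \<Rightarrow> 'v" and p :: 'v and K r :: real
  assumes complete: "complete (UNIV :: 'v set)"
    and bil: "bounded_bilinear \<beta>"
    and K: "\<And>x y. norm (\<beta> x y) \<le> norm x * norm y * K" "0 \<le> K"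
    and r: "0 < r" "4 * (K * r) \<le> 1"
begin

sublocale \<beta>: bounded_bilinear \<beta>
  by (fact bil)

definition \<phi> where "\<phi> x = (x - p) + \<beta> (x - p) (x - p)"
text \<open>\<open>B u\<close> is the derivative of \<open>u \<mapsto> \<beta> u u\<close>.\<close>

definition B where "B u w = \<beta> u w + \<beta> w u"
text \<open>With radius \<open>r / 2\<close>, solving \<open>\<phi> x = y\<close> by iteration never
  leaves the ball of radius \<open>r\<close> around \<open>p\<close>.\<close>

definition W where "W = ball (0 :: 'v) (r / 2)"
definition U where "U = {x \<in> ball p r. \<phi> x \<in> W}"

section \<open>Bounds on the quadratic part and inversion of the derivative\<close>

lemma B_bound: "norm (B u w) \<le> 2 * K * norm u * norm w"
  unfolding B_def using K(1)[of u w] K(1)[of w u] norm_triangle_ineq[of "\<beta> u w" "\<beta> w u"]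
  by (simp add: mult_ac)

sublocale B: bounded_bilinear B
proof
  show "\<exists>K. \<forall>u w. norm (B u w) \<le> norm u * norm w * K"
    using B_bound by (intro exI[of _ "2 * K"]) (simp add: mult_ac)
qed (simp_all add: B_def \<beta>.add_left \<beta>.add_right \<beta>.scaleR_left \<beta>.scaleR_right scaleR_add_right)

lemma \<beta>_half: "norm u \<le> r \<Longrightarrow> norm (\<beta> u w) \<le> norm w / 4" "norm u \<le> r \<Longrightarrow> norm (\<beta> w u) \<le> norm w / 4"
proof -
  assume u: "norm u \<le> r"
  have "norm u * norm w * K \<le> (K * r) * norm w"
    using mult_right_mono[OF u, of "norm w * K"] K(2) by (simp add: mult_ac)
  also have "\<dots> \<le> (1 / 4) * norm w"
    using r(2) by (intro mult_right_mono) auto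
  finally show "norm (\<beta> u w) \<le> norm w / 4" "norm (\<beta> w u) \<le> norm w / 4"
    using K(1)[of u w] K(1)[of w u] by (auto simp: mult_ac)
qed

lemma B_half: "norm u \<le> r \<Longrightarrow> norm (B u w) \<le> norm w / 2"
  unfolding B_def using \<beta>_half[of u w] norm_triangle_ineq[of "\<beta> u w" "\<beta> w u"] by simp

text \<open>The derivative of \<open>\<phi>\<close> at \<open>p + x\<close> is
  \<open>h \<mapsto> h + B x h\<close>; since \<open>B x\<close> has norm at most 1/2, the map
  \<open>h \<mapsto> v - B x h\<close> is a contraction.\<close>

lemma tangent_solvable:
  assumes "norm x \<le> r"
  shows "\<exists>!h. h + B x h = v"
proof -
  have "\<exists>!h\<in>UNIV. v - B x h = h"
  proof (rule Banach_fix[OF complete, of "1/2"])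
    fix h k
    have "norm ((v - B x h) - (v - B x k)) = norm (B x (h - k))"
      by (simp add: B.diff_right norm_minus_commute)
    then show "dist (v - B x h) (v - B x k) \<le> 1 / 2 * dist h k"
      using B_half[OF assms, of "h - k"] by (simp add: dist_norm)
  qed auto
  moreover have "v - B x h = h \<longleftrightarrow> h + B x h = v" for h
    by (auto simp: algebra_simps)
  ultimately show ?thesis
    by simp
qed

definition inv_tangent where "inv_tangent x v = (THE h. h + B x h = v)"

lemma inv_tangent: "norm x \<le> r \<Longrightarrow> inv_tangent x v + B x (inv_tangent x v) = v"
  unfolding inv_tangent_def by (rule theI') (rule tangent_solvable)

lemma inv_tangent_eqI: "norm x \<le> r \<Longrightarrow> h + B x h = v \<Longrightarrow> inv_tangent x v = h"
  using inv_tangent tangent_solvable by blast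

lemma norm_inv_tangent: "norm x \<le> r \<Longrightarrow> norm (inv_tangent x v) \<le> norm v * 2"
  using inv_tangent[of x v] B_half[of x "inv_tangent x v"]
    norm_triangle_ineq4[of v "B x (inv_tangent x v)"]
  by (simp add: eq_diff_eq[symmetric])

lemma bounded_linear_inv_tangent:
  assumes "norm x \<le> r"
  shows "bounded_linear (inv_tangent x)"
proof (rule bounded_linear_intro)
  fix u v c
  show "inv_tangent x (u + v) = inv_tangent x u + inv_tangent x v"
  proof (rule inv_tangent_eqI[OF assms])
    have "inv_tangent x u + inv_tangent x v + B x (inv_tangent x u + inv_tangent x v)
        = (inv_tangent x u + B x (inv_tangent x u)) + (inv_tangent x v + B x (inv_tangent x v))"
      by (simp add: B.add_right)
    then show "inv_tangent x u + inv_tangent x v + B x (inv_tangent x u + inv_tangent x v) = u + v"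
      by (simp only: inv_tangent[OF assms])
  qed
  show "inv_tangent x (c *\<^sub>R v) = c *\<^sub>R inv_tangent x v"
  proof (rule inv_tangent_eqI[OF assms])
    have "c *\<^sub>R inv_tangent x v + B x (c *\<^sub>R inv_tangent x v)
        = c *\<^sub>R (inv_tangent x v + B x (inv_tangent x v))"
      by (simp add: B.scaleR_right scaleR_add_right)
    then show "c *\<^sub>R inv_tangent x v + B x (c *\<^sub>R inv_tangent x v) = c *\<^sub>R v"
      by (simp only: inv_tangent[OF assms])
  qed
  show "norm (inv_tangent x v) \<le> norm v * 2"
    by (rule norm_inv_tangent[OF assms])
qed

section \<open>The local homeomorphism\<close>

lemma \<beta>_diff_le:
  assumes "norm u \<le> r" "norm w \<le> r"
  shows "norm (\<beta> u u - \<beta> w w) \<le> norm (u - w) / 2"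
proof -
  have "\<beta> u u - \<beta> w w = \<beta> u (u - w) + \<beta> (u - w) w"
    by (simp add: \<beta>.diff_left \<beta>.diff_right)
  then show ?thesis
    using \<beta>_half(1)[OF assms(1), of "u - w"] \<beta>_half(2)[OF assms(2), of "u - w"]
      norm_triangle_ineq[of "\<beta> u (u - w)" "\<beta> (u - w) w"] by simp
qed

text \<open>The quadratic part is 1/2-Lipschitz and cannot undo more than half of a displacement.
  This yields both injectivity and the Lipschitz bound for the inverse.\<close>

lemma \<phi>_expanding:
  assumes "norm (x - p) \<le> r" "norm (y - p) \<le> r"
  shows "norm (x - y) \<le> 2 * norm (\<phi> x - \<phi> y)"
proof -
  have "x - y = (\<phi> x - \<phi> y) - (\<beta> (x - p) (x - p) - \<beta> (y - p) (y - p))"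
    by (simp add: \<phi>_def)
  then show ?thesis
    using \<beta>_diff_le[OF assms] norm_triangle_ineq4[of "\<phi> x - \<phi> y" "\<beta> (x - p) (x - p) - \<beta> (y - p) (y - p)"]
    by simp
qed

lemma U_norm: "x \<in> U \<Longrightarrow> norm (x - p) \<le> r"
  by (auto simp: U_def dist_norm norm_minus_commute)

lemma \<phi>_surj:
  assumes "y \<in> W"
  shows "y \<in> \<phi> ` U"
proof -
  have y: "norm y < r / 2"
    using assms by (simp add: W_def)
  \<comment> \<open>The bound is strict since \<open>r / 2 + r / 4 < r\<close>; so the fixed point
    found in the closed ball lies in the open ball, as membership in \<open>U\<close>
    requires.\<close>
  have mem: "norm (y - \<beta> u u) < r" if "norm u \<le> r" for u
    using \<beta>_half(1)[OF that, of u] that y norm_triangle_ineq4[of y "\<beta> u u"] r(1) by linarith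
  have "\<exists>!u\<in>cball 0 r. y - \<beta> u u = u"
  proof (rule Banach_fix[of _ "1/2"])
    show "complete (cball (0 :: 'v) r)"
      using complete complete_closed_subset by blast
    show "(\<lambda>u. y - \<beta> u u) ` cball 0 r \<subseteq> cball 0 r"
      using mem by (auto simp: less_imp_le)
    show "dist (y - \<beta> u u) (y - \<beta> w w) \<le> 1 / 2 * dist u w"
      if "u \<in> cball 0 r" "w \<in> cball 0 r" for u w
      using \<beta>_diff_le[of u w] that by (simp add: dist_norm norm_minus_commute)
  qed (use r in auto)
  then obtain u where u: "norm u \<le> r" "y - \<beta> u u = u"
    by auto
  then have "norm u < r" "\<phi> (u + p) = y"
    using mem[OF u(1)] by (auto simp: \<phi>_def algebra_simps)
  then show ?thesis
    using assms unfolding U_def by (intro image_eqI[of _ _ "u + p"]) (auto simp: dist_norm)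
qed

lemma inj_\<phi>: "inj_on \<phi> U"
  using \<phi>_expanding U_norm by (fastforce intro: inj_onI)

definition \<psi> where "\<psi> = inv_into U \<phi>"

lemma \<psi>_mem: "y \<in> W \<Longrightarrow> \<psi> y \<in> U"
  unfolding \<psi>_def using \<phi>_surj by (rule inv_into_into)

lemma \<phi>_\<psi>: "y \<in> W \<Longrightarrow> \<phi> (\<psi> y) = y"
  unfolding \<psi>_def using \<phi>_surj by (rule f_inv_into_f)

lemma \<psi>_\<phi>: "x \<in> U \<Longrightarrow> \<psi> (\<phi> x) = x"
  unfolding \<psi>_def using inj_\<phi> by (rule inv_into_f_f)

lemma \<psi>_norm: "y \<in> W \<Longrightarrow> norm (\<psi> y - p) \<le> r"
  using \<psi>_mem U_norm by blast

lemma \<psi>_lipschitz: "y \<in> W \<Longrightarrow> z \<in> W \<Longrightarrow> norm (\<psi> y - \<psi> z) \<le> 2 * norm (y - z)"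
  using \<phi>_expanding[of "\<psi> y" "\<psi> z"] by (simp add: \<psi>_norm \<phi>_\<psi>)

lemma \<phi>_has_derivative: "(\<phi> has_derivative (\<lambda>h. h + B (x - p) h)) (at x)"
proof -
  have "((\<lambda>x. (x - p) + \<beta> (x - p) (x - p)) has_derivative
      (\<lambda>h. (h - 0) + (\<beta> (x - p) (h - 0) + \<beta> (h - 0) (x - p)))) (at x)"
    by (intro derivative_intros \<beta>.FDERIV)
  then show ?thesis
    by (simp add: \<phi>_def[abs_def] B_def)
qed

lemma open_W: "open W"
  by (simp add: W_def)

lemma continuous_\<phi>: "continuous_on S \<phi>"
  by (meson \<phi>_has_derivative continuous_at_imp_continuous_on has_derivative_continuous)

lemma open_U: "open U"
proof -
  have "U = ball p r \<inter> \<phi> -` W"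
    by (auto simp: U_def)
  then show ?thesis
    using open_W continuous_\<phi> by (simp add: open_Int open_vimage)
qed

lemma p_mem_U: "p \<in> U"
  using r by (simp add: U_def \<phi>_def W_def \<beta>.zero_left)

lemma continuous_\<psi>: "continuous_on W \<psi>"
proof (rule lipschitz_on_continuous_on)
  show "2-lipschitz_on W \<psi>"
    using \<psi>_lipschitz by (auto intro!: lipschitz_onI simp: dist_norm)
qed

lemma homeomorphism_\<phi>: "homeomorphism U W \<phi> \<psi>"
proof (rule homeomorphismI)
  show "\<phi> ` U \<subseteq> W"
    by (auto simp: U_def)
qed (auto simp: continuous_\<phi> continuous_\<psi> \<psi>_mem \<phi>_\<psi> \<psi>_\<phi>)

section \<open>Derivatives of the inverse map\<close>

lemma \<psi>_has_derivative:
  assumes "y \<in> W"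
  shows "(\<psi> has_derivative inv_tangent (\<psi> y - p)) (at y)"
proof (rule has_derivative_inverse_basic[OF \<phi>_has_derivative _ _ _ open_W assms])
  show "bounded_linear (inv_tangent (\<psi> y - p))"
    by (intro bounded_linear_inv_tangent \<psi>_norm assms)
  show "inv_tangent (\<psi> y - p) \<circ> (\<lambda>h. h + B (\<psi> y - p) h) = id"
    using inv_tangent_eqI[OF \<psi>_norm[OF assms]] by (simp add: fun_eq_iff)
  show "continuous (at y) \<psi>"
    using continuous_\<psi> assms open_W continuous_on_eq_continuous_at by blast
qed (rule \<phi>_\<psi>)

text \<open>\<open>G = inv_tangent (\<psi> - p) f\<close> solves \<open>G + B (\<psi> - p) G = f\<close>; comparing this equation at \<open>z\<close>
  and at \<open>y\<close> writes \<open>G z\<close> as the value of the fixed linear map \<open>inv_tangent (\<psi> y - p)\<close> at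
  \<open>f z - B (\<psi> z - \<psi> y) (G z)\<close>, where \<open>G z\<close> may be replaced by \<open>G y\<close> up to first order.\<close>

lemma inv_tangent_has_derivative:
  assumes y: "y \<in> W" and f: "(f has_derivative f') (at y)"
  defines "I \<equiv> inv_tangent (\<psi> y - p)"
  shows "((\<lambda>z. inv_tangent (\<psi> z - p) (f z)) has_derivative (\<lambda>k. I (f' k - B (I k) (I (f y))))) (at y)"
proof -
  define G where "G z = inv_tangent (\<psi> z - p) (f z)" for z
  interpret I: bounded_linear I
    unfolding I_def by (intro bounded_linear_inv_tangent \<psi>_norm y)
  have normI: "norm (I v) \<le> 2 * norm v" for v
    unfolding I_def using norm_inv_tangent[OF \<psi>_norm[OF y]] by (simp add: mult_ac)
  have G_eq: "G z = I (f z - B (\<psi> z - \<psi> y) (G z))" if "z \<in> W" for z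
    unfolding I_def
  proof (rule inv_tangent_eqI[symmetric, OF \<psi>_norm[OF y]])
    have "G z + B (\<psi> z - p) (G z) = f z"
      unfolding G_def by (intro inv_tangent \<psi>_norm that)
    then show "G z + B (\<psi> y - p) (G z) = f z - B (\<psi> z - \<psi> y) (G z)"
      by (simp add: B.diff_left algebra_simps)
  qed
  have W: "\<forall>\<^sub>F z in at y. z \<in> W"
    using y open_W by (simp add: eventually_at_in_open')
  have f_lim: "(f \<longlongrightarrow> f y) (at y)"
    using f has_derivative_continuous isCont_def by blast
  have B_\<psi>: "norm (B (\<psi> z - \<psi> y) w) \<le> 4 * K * norm (z - y) * norm w" if "z \<in> W" for z w
  proof -
    have "norm (B (\<psi> z - \<psi> y) w) \<le> (2 * K * norm w) * norm (\<psi> z - \<psi> y)"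
      using B_bound[of "\<psi> z - \<psi> y" w] by (simp add: mult_ac)
    also have "\<dots> \<le> (2 * K * norm w) * (2 * norm (z - y))"
      by (intro mult_left_mono \<psi>_lipschitz that y) (simp add: K)
    finally show ?thesis
      by (simp add: mult_ac)
  qed
  \<comment> \<open>Continuity of \<open>G\<close> at \<open>y\<close> comes first. The term
    containing \<open>G z\<close> is controlled by the uniform bound
    \<open>norm (G z) \<le> 2 * norm (f z)\<close> and the factor
    \<open>norm (z - y)\<close>.\<close>
  have G_lim: "((\<lambda>z. G z - G y) \<longlongrightarrow> 0) (at y)"
  proof (rule Lim_null_comparison)
    show "\<forall>\<^sub>F z in at y. norm (G z - G y) \<le> 2 * (norm (f z - f y) + 4 * K * norm (z - y) * (norm (f z) * 2))"
      using W
    proof eventually_elim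
      case (elim z)
      have "G z - G y = I (f z - B (\<psi> z - \<psi> y) (G z)) - I (f y)"
        using G_eq[OF elim] G_eq[OF y] by (simp add: B.zero_left)
      also have "\<dots> = I ((f z - f y) - B (\<psi> z - \<psi> y) (G z))"
        by (simp add: I.diff)
      finally have "norm (G z - G y) \<le> 2 * norm ((f z - f y) - B (\<psi> z - \<psi> y) (G z))"
        using normI by simp
      moreover have "norm ((f z - f y) - B (\<psi> z - \<psi> y) (G z))
          \<le> norm (f z - f y) + 4 * K * norm (z - y) * (norm (f z) * 2)"
      proof (rule order.trans[OF norm_triangle_ineq4 add_left_mono])
        have "4 * K * norm (z - y) * norm (G z) \<le> 4 * K * norm (z - y) * (norm (f z) * 2)"
          unfolding G_def by (intro mult_left_mono norm_inv_tangent \<psi>_norm elim) (simp add: K)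
        then show "norm (B (\<psi> z - \<psi> y) (G z)) \<le> 4 * K * norm (z - y) * (norm (f z) * 2)"
          using B_\<psi>[OF elim] by (rule order.trans[rotated])
      qed
      ultimately show ?case
        by (meson mult_left_mono order.trans zero_le_numeral)
    qed
    have "((\<lambda>z. 2 * (norm (f z - f y) + 4 * K * norm (z - y) * (norm (f z) * 2))) \<longlongrightarrow>
        2 * (norm (f y - f y) + 4 * K * norm (y - y) * (norm (f y) * 2))) (at y)"
      by (intro tendsto_intros f_lim)
    then show "((\<lambda>z. 2 * (norm (f z - f y) + 4 * K * norm (z - y) * (norm (f z) * 2))) \<longlongrightarrow> 0) (at y)"
      by simp
  qed
  \<comment> \<open>\<open>R\<close> is the error made by freezing \<open>G z\<close> at
    \<open>G y\<close>: it is \<open>O(norm (z - y))\<close> times a quantity tending to 0, hence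
    has derivative 0 at \<open>y\<close>.\<close>
  define R where "R z = B (\<psi> z - \<psi> y) (G z - G y)" for z
  have R: "(R has_derivative (\<lambda>_. 0)) (at y)"
    unfolding has_derivative_iff_norm
  proof
    show "((\<lambda>z. norm (R z - R y - 0) / norm (z - y)) \<longlongrightarrow> 0) (at y)"
    proof (rule Lim_null_comparison)
      show "\<forall>\<^sub>F z in at y. norm (norm (R z - R y - 0) / norm (z - y)) \<le> 4 * K * norm (G z - G y)"
        using W eventually_neq_at_within[of y]
      proof eventually_elim
        case (elim z)
        then show ?case
          using B_\<psi>[OF elim(1), of "G z - G y"]
          by (simp add: R_def B.zero_left field_simps)
      qed
      show "((\<lambda>z. 4 * K * norm (G z - G y)) \<longlongrightarrow> 0) (at y)"
        using tendsto_mult_left[OF tendsto_norm_zero[OF G_lim], of "4 * K"] by simp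
    qed
  qed simp
  have "((\<lambda>z. f z - B (\<psi> z - \<psi> y) (G y) - R z) has_derivative (\<lambda>k. f' k - B (I k - 0) (G y) - 0)) (at y)"
    unfolding I_def
    by (intro derivative_intros f R bounded_linear.has_derivative[OF B.bounded_linear_left]
        \<psi>_has_derivative y)
  then have "((\<lambda>z. I (f z - B (\<psi> z - \<psi> y) (G y) - R z)) has_derivative
      (\<lambda>k. I (f' k - B (I k - 0) (G y) - 0))) (at y)"
    by (rule I.has_derivative)
  then have "((\<lambda>z. I (f z - B (\<psi> z - \<psi> y) (G y) - R z)) has_derivative
      (\<lambda>k. I (f' k - B (I k) (I (f y))))) (at y)"
    by (simp add: G_def I_def)
  then have "(G has_derivative (\<lambda>k. I (f' k - B (I k) (I (f y))))) (at y)"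
  proof (rule has_derivative_transform_within_open[OF _ open_W y])
    fix z assume "z \<in> W"
    then show "I (f z - B (\<psi> z - \<psi> y) (G y) - R z) = G z"
      by (subst G_eq) (simp_all add: R_def B.diff_right algebra_simps)
  qed
  then show ?thesis
    by (simp add: G_def[abs_def])
qed

section \<open>Smoothness of the map and its inverse\<close>

lemma smooth_\<phi>: "smooth_on U \<phi>"
proof (rule smooth_on_coinduct[OF open_U,
    \<comment> \<open>The directional derivatives of \<open>\<phi>\<close> are affine in
      \<open>x\<close>, and those of an affine map are constant, so this class is closed.\<close>
    where P = "\<lambda>f. f = \<phi> \<or> (\<exists>L c. bounded_linear L \<and> f = (\<lambda>x. L x + c))"])
  fix f assume "f = \<phi> \<or> (\<exists>L c. bounded_linear L \<and> f = (\<lambda>x. L x + c))"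
  then show "\<exists>D. (\<forall>x\<in>U. (f has_derivative D x) (at x)) \<and>
    (\<forall>v. (\<lambda>x. D x v) = \<phi> \<or> (\<exists>L c. bounded_linear L \<and> (\<lambda>x. D x v) = (\<lambda>x. L x + c)))"
  proof (elim disjE exE conjE)
    assume f: "f = \<phi>"
    have "(\<lambda>x. v + B (x - p) v) = (\<lambda>x. B x v + (v - B p v))" for v
      by (simp add: B.diff_left fun_eq_iff)
    then show ?thesis
      using f \<phi>_has_derivative B.bounded_linear_left
      by (intro exI[of _ "\<lambda>x h. h + B (x - p) h"]) blast
  next
    fix L c assume f: "bounded_linear L" "f = (\<lambda>x. L x + c)"
    have "(f has_derivative L) (at x)" for x
      unfolding f(2) using bounded_linear_imp_has_derivative[OF f(1)] by (rule has_derivative_add_const)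
    moreover have "(\<lambda>_. L v) = (\<lambda>x :: 'v. 0 + L v)" for v
      by simp
    ultimately show ?thesis
      using bounded_linear_zero by (intro exI[of _ "\<lambda>x. L"]) blast
  qed
qed simp

text \<open>A class around \<open>\<psi>\<close> closed under directional derivatives.
  Differentiating \<open>\<psi>\<close> produces \<open>inv\<close> applied to a constant,
  differentiating \<open>inv\<close> produces \<open>diff\<close>, \<open>bil\<close> and
  \<open>inv\<close>, and the product rule for \<open>bil\<close> produces
  \<open>add\<close>.\<close>

inductive inverse_term :: "('v \<Rightarrow> 'v) \<Rightarrow> bool" where
  base: "inverse_term \<psi>"
| const: "inverse_term (\<lambda>_. c)"
| diff: "inverse_term f \<Longrightarrow> inverse_term g \<Longrightarrow> inverse_term (\<lambda>y. f y - g y)"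
| add: "inverse_term f \<Longrightarrow> inverse_term g \<Longrightarrow> inverse_term (\<lambda>y. f y + g y)"
| bil: "inverse_term f \<Longrightarrow> inverse_term g \<Longrightarrow> inverse_term (\<lambda>y. B (f y) (g y))"
| inv: "inverse_term f \<Longrightarrow> inverse_term (\<lambda>y. inv_tangent (\<psi> y - p) (f y))"

lemma smooth_\<psi>: "smooth_on W \<psi>"
proof (rule smooth_on_coinduct[OF open_W, where P = inverse_term])
  fix f assume "inverse_term f"
  then show "\<exists>D. (\<forall>y\<in>W. (f has_derivative D y) (at y)) \<and> (\<forall>v. inverse_term (\<lambda>y. D y v))"
  proof induction
    case base
    show ?case
      using \<psi>_has_derivative by (intro exI[of _ "\<lambda>y. inv_tangent (\<psi> y - p)"])
        (auto intro: inverse_term.intros)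
  next
    case (const c)
    show ?case
      by (intro exI[of _ "\<lambda>_ _. 0"]) (auto intro: inverse_term.intros)
  next
    case (diff f g)
    then obtain D E where "\<forall>y\<in>W. (f has_derivative D y) (at y)" "\<forall>v. inverse_term (\<lambda>y. D y v)"
      "\<forall>y\<in>W. (g has_derivative E y) (at y)" "\<forall>v. inverse_term (\<lambda>y. E y v)"
      by blast
    then show ?case
      by (intro exI[of _ "\<lambda>y h. D y h - E y h"])
        (auto intro!: inverse_term.intros(2-) has_derivative_diff)
  next
    case (add f g)
    then obtain D E where "\<forall>y\<in>W. (f has_derivative D y) (at y)" "\<forall>v. inverse_term (\<lambda>y. D y v)"
      "\<forall>y\<in>W. (g has_derivative E y) (at y)" "\<forall>v. inverse_term (\<lambda>y. E y v)"
      by blast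
    then show ?case
      by (intro exI[of _ "\<lambda>y h. D y h + E y h"])
        (auto intro!: inverse_term.intros(2-) has_derivative_add)
  next
    case (bil f g)
    then obtain D E where "\<forall>y\<in>W. (f has_derivative D y) (at y)" "\<forall>v. inverse_term (\<lambda>y. D y v)"
      "\<forall>y\<in>W. (g has_derivative E y) (at y)" "\<forall>v. inverse_term (\<lambda>y. E y v)"
      by blast
    then show ?case
      using bil.hyps by (intro exI[of _ "\<lambda>y h. B (f y) (E y h) + B (D y h) (g y)"])
        (auto intro!: inverse_term.add inverse_term.bil B.FDERIV)
  next
    case (inv f)
    then obtain D where "\<forall>y\<in>W. (f has_derivative D y) (at y)" "\<forall>v. inverse_term (\<lambda>y. D y v)"
      by blast
    then show ?case
      using inv.hyps
      by (intro exI[of _ "\<lambda>y k. inv_tangent (\<psi> y - p)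
          (D y k - B (inv_tangent (\<psi> y - p) k) (inv_tangent (\<psi> y - p) (f y)))"])
        (auto intro!: inverse_term.inv inverse_term.diff inverse_term.bil inverse_term.const
          inv_tangent_has_derivative)
  qed
qed (rule inverse_term.base)

end

section \<open>The Jacobiator and the Chevalley--Eilenberg differential\<close>

lemma skew_apply_swap: "skew_apply b x y = - skew_apply b y x"
  unfolding skew_apply_def by transfer blast

lemma skew_apply_self [simp]: "skew_apply b x x = 0"
proof -
  have "skew_apply b x x + skew_apply b x x = 0"
    using skew_apply_swap[of b x x] eq_neg_iff_add_eq_0 by blast
  then show ?thesis
    using scaleR_half_double[of "skew_apply b x x"] by simp
qed

lemma skew_apply_plus: "skew_apply (a + b) x y = skew_apply a x y + skew_apply b x y"
  by (simp add: skew_apply_def plus_skew_bilinear.rep_eq blinfun.add_left)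

lemma skew_apply_scaleR: "skew_apply (c *\<^sub>R b) x y = c *\<^sub>R skew_apply b x y"
  by (simp add: skew_apply_def scaleR_skew_bilinear.rep_eq blinfun.scaleR_left)

lemma bilinear_skew_apply: "bilinear (skew_apply b)"
  unfolding bilinear_def skew_apply_def
  by (auto intro!: linearI simp: blinfun.add_left blinfun.add_right blinfun.scaleR_left blinfun.scaleR_right)

lemmas skew_apply_bilinear_simps =
  bilinear_ladd[OF bilinear_skew_apply] bilinear_radd[OF bilinear_skew_apply]
  bilinear_lmul[OF bilinear_skew_apply] bilinear_rmul[OF bilinear_skew_apply]
  bilinear_lsub[OF bilinear_skew_apply] bilinear_rsub[OF bilinear_skew_apply]
  bilinear_lneg[OF bilinear_skew_apply] bilinear_rneg[OF bilinear_skew_apply]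
  bilinear_lzero[OF bilinear_skew_apply] bilinear_rzero[OF bilinear_skew_apply]

lemma skew_bilinear_eqI:
  "(\<And>x y. skew_apply a x y = skew_apply b x y) \<Longrightarrow> a = b"
  unfolding skew_apply_def by (simp add: blinfun_of_skew_inject[symmetric] blinfun_eqI)

text \<open>Finite dimension bounds \<open>f\<close> jointly, which bounds both the partial maps and
  the curried map, so the type misses no skew-symmetric bilinear map.\<close>

lemma skew_bilinear_exhaust:
  fixes f :: "'a::real_normed_vector \<Rightarrow> 'a \<Rightarrow> 'a"
  assumes fd: "\<exists>B :: 'a set. finite B \<and> span B = UNIV"
    and bil: "bilinear f" and skew: "\<And>x y. f x y = - f y x"
  obtains b where "skew_apply b = f"
proof -
  interpret f: bounded_bilinear f
    by (rule bilinear_imp_bounded_bilinear[OF fd fd bil])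
  obtain K where K: "0 < K" "\<And>x y. norm (f x y) \<le> norm x * norm y * K"
    using f.pos_bounded by blast
  have F: "blinfun_apply (Blinfun (f x)) = f x" for x
    by (rule bounded_linear_Blinfun_apply) (rule f.bounded_linear_right)
  have "bounded_linear (\<lambda>x. Blinfun (f x))"
  proof (rule bounded_linear_intro)
    show "norm (Blinfun (f x)) \<le> norm x * K" for x
    proof (rule norm_blinfun_bound)
      show "norm (blinfun_apply (Blinfun (f x)) y) \<le> norm x * K * norm y" for y
        using K(2)[of x y] by (simp add: F mult_ac)
    qed (use K(1) in simp)
  qed (auto intro!: blinfun_eqI simp: F f.add_left f.scaleR_left blinfun.add_left blinfun.scaleR_left)
  then obtain g where g: "\<And>x y. blinfun_apply (blinfun_apply g x) y = f x y"
    using F by (metis bounded_linear_Blinfun_apply)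
  have "blinfun_of_skew (Abs_skew_bilinear g) = g"
    by (rule Abs_skew_bilinear_inverse) (unfold mem_Collect_eq g, blast intro: skew)
  then show ?thesis
    using that[of "Abs_skew_bilinear g"] by (simp add: skew_apply_def g fun_eq_iff)
qed

text \<open>Identifies the normed space of brackets with the unnormed 2-cochains on lists.\<close>

definition cochain_of :: "'a::real_normed_vector skew_bilinear \<Rightarrow> 'a list \<Rightarrow> 'a" where
  "cochain_of b xs = (if length xs = 2 then skew_apply b (xs ! 0) (xs ! 1) else 0)"

text \<open>Polarized: the Jacobiator of \<open>b\<close> is \<open>jacobiator b b\<close>.\<close>

definition jacobiator ::
  "'a::real_normed_vector skew_bilinear \<Rightarrow> 'a skew_bilinear \<Rightarrow> 'a list \<Rightarrow> 'a" where
  "jacobiator a b xs = (if length xs = 3 then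
     skew_apply a (xs ! 0) (skew_apply b (xs ! 1) (xs ! 2))
     + skew_apply a (xs ! 1) (skew_apply b (xs ! 2) (xs ! 0))
     + skew_apply a (xs ! 2) (skew_apply b (xs ! 0) (xs ! 1)) else 0)"

lemma linear_cochain_of: "linear cochain_of"
  by (rule linearI) (simp_all add: cochain_of_def fun_eq_iff scaleR_fun_def skew_apply_plus skew_apply_scaleR)

lemma inj_cochain_of: "inj cochain_of"
proof (rule injI, rule skew_bilinear_eqI)
  fix a b :: "'a skew_bilinear" and x y
  assume "cochain_of a = cochain_of b"
  then have "cochain_of a [x, y] = cochain_of b [x, y]"
    by simp
  then show "skew_apply a x y = skew_apply b x y"
    by (simp add: cochain_of_def)
qed

lemma bilinear_jacobiator: "bilinear jacobiator"
  unfolding bilinear_def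
  by (auto intro!: linearI simp: jacobiator_def fun_eq_iff scaleR_fun_def skew_apply_plus
      skew_apply_scaleR skew_apply_bilinear_simps algebra_simps)

lemma lie_structures_iff: "b \<in> lie_structures \<longleftrightarrow> jacobiator b b = 0"
proof
  assume "b \<in> lie_structures"
  then show "jacobiator b b = 0"
    by (auto simp: lie_structures_def jacobiator_def fun_eq_iff)
next
  assume J: "jacobiator b b = 0"
  have "skew_apply b x (skew_apply b y z) + skew_apply b y (skew_apply b z x)
       + skew_apply b z (skew_apply b x y) = jacobiator b b [x, y, z]" for x y z
    by (simp add: jacobiator_def)
  then show "b \<in> lie_structures"
    using J by (simp add: lie_structures_def)
qed

lemma length_3_cases:
  assumes "length xs = 3"
  obtains x y z where "xs = [x, y, z]"
  using assms by (auto simp: length_Suc_conv numeral_3_eq_3)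

text \<open>When two arguments coincide, one cyclic term contains a bracket of a vector with itself
  and the other two cancel by skew-symmetry.\<close>

lemma jacobiator_cochain: "jacobiator b b \<in> cochains 3"
proof -
  have "linear (\<lambda>v. jacobiator b b (xs[i := v]))" if "length xs = 3" "i < 3" for xs i
  proof -
    obtain x y z where xs: "xs = [x, y, z]"
      using length_3_cases \<open>length xs = 3\<close> .
    have "i = 0 \<or> i = 1 \<or> i = 2"
      using \<open>i < 3\<close> by auto
    then show ?thesis
      by (auto simp: xs jacobiator_def skew_apply_bilinear_simps algebra_simps intro!: linearI)
  qed
  moreover have "jacobiator b b xs = 0"
    if "length xs = 3" "i < j" "j < 3" "xs ! i = xs ! j" for xs i j
  proof -
    obtain x y z where xs: "xs = [x, y, z]"
      using length_3_cases \<open>length xs = 3\<close> .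
    have "(i = 0 \<and> j = 1) \<or> (i = 0 \<and> j = 2) \<or> (i = 1 \<and> j = 2)"
      using that by auto
    then show ?thesis
      using that(4) skew_apply_swap[of b x z] skew_apply_swap[of b x y]
      by (auto simp: xs jacobiator_def skew_apply_bilinear_simps)
  qed
  ultimately show ?thesis
    by (auto simp: cochains_def jacobiator_def)
qed

lemma ce_diff_2:
  "ce_diff m 2 \<omega> [x, y, z] = m x (\<omega> [y, z]) - m y (\<omega> [x, z]) + m z (\<omega> [x, y])
     - \<omega> [m x y, z] + \<omega> [m x z, y] - \<omega> [m y z, x]"
  by (simp add: ce_diff_def omit_def numeral_2_eq_2 lessThan_Suc atMost_Suc)

lemma ce_diff_3:
  "ce_diff m 3 \<omega> [x, y, z, w] =
     m x (\<omega> [y, z, w]) - m y (\<omega> [x, z, w]) + m z (\<omega> [x, y, w]) - m w (\<omega> [x, y, z])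
     - \<omega> [m x y, z, w] + \<omega> [m x z, y, w] - \<omega> [m x w, y, z]
     - \<omega> [m y z, x, w] + \<omega> [m y w, x, z] - \<omega> [m z w, x, y]"
  by (simp add: ce_diff_def omit_def numeral_3_eq_3 lessThan_Suc atMost_Suc)

text \<open>The differential of \<open>m\<close> on 2-cochains is the linearization of the
  Jacobiator at \<open>m\<close>; neither bracket has to satisfy the Jacobi identity.\<close>

lemma ce_diff_cochain_of:
  "ce_diff (skew_apply m) 2 (cochain_of a) = jacobiator m a + jacobiator a m"
proof
  fix xs :: "'a list"
  show "ce_diff (skew_apply m) 2 (cochain_of a) xs = (jacobiator m a + jacobiator a m) xs"
  proof (cases "length xs = 3")
    case False
    then show ?thesis
      by (simp add: ce_diff_def jacobiator_def)
  next
    case True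
    then obtain x y z where "xs = [x, y, z]"
      using length_3_cases by blast
    then show ?thesis
      using skew_apply_swap[of a x z] skew_apply_swap[of m x z]
        skew_apply_swap[of a "skew_apply m x y" z] skew_apply_swap[of a "skew_apply m z x" y]
        skew_apply_swap[of a "skew_apply m y z" x]
      by (simp add: ce_diff_2 cochain_of_def jacobiator_def skew_apply_bilinear_simps)
  qed
qed

text \<open>The graded Jacobi identity, valid for every skew-symmetric \<open>b\<close>: once
  skew-symmetry brings all triple brackets to a normal form, they cancel.\<close>

lemma ce_diff_jacobiator: "ce_diff (skew_apply b) 3 (jacobiator b b) = 0"
proof
  fix xs :: "'a list"
  show "ce_diff (skew_apply b) 3 (jacobiator b b) xs = 0 xs"
  proof (cases "length xs = 4")
    case False
    then show ?thesis
      by (simp add: ce_diff_def)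
  next
    case True
    then obtain x y z w where xs: "xs = [x, y, z, w]"
      by (auto simp: length_Suc_conv eval_nat_numeral)
    let ?b = "skew_apply b"
    have s: "?b y x = - ?b x y" "?b z x = - ?b x z" "?b w x = - ?b x w"
      "?b z y = - ?b y z" "?b w y = - ?b y w" "?b w z = - ?b z w"
      by (rule skew_apply_swap)+
    \<comment> \<open>Inner brackets are moved to the right only past one of the four variables;
      without this restriction the rewriting would loop on brackets of two brackets, which
      \<open>q\<close> orients separately.\<close>
    have t: "?b (?b u v) c = - ?b c (?b u v)" if "c = x \<or> c = y \<or> c = z \<or> c = w" for u v c
      by (rule skew_apply_swap)
    have q: "?b (?b z w) (?b x y) = - ?b (?b x y) (?b z w)"
      "?b (?b y w) (?b x z) = - ?b (?b x z) (?b y w)"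
      "?b (?b y z) (?b x w) = - ?b (?b x w) (?b y z)"
      by (rule skew_apply_swap)+
    show ?thesis
      by (simp add: xs ce_diff_3 jacobiator_def s t q skew_apply_bilinear_simps)
  qed
qed

section \<open>Linearity of the differential and finite dimension of the cochain spaces\<close>

lemma linear_ce_diff:
  assumes "\<And>x. linear (m x)"
  shows "linear (ce_diff m k)"
proof (rule linearI)
  fix \<omega> \<eta> :: "'a list \<Rightarrow> 'a" and c
  show "ce_diff m k (\<omega> + \<eta>) = ce_diff m k \<omega> + ce_diff m k \<eta>"
    by (auto simp: ce_diff_def fun_eq_iff linear_add[OF assms] scaleR_add_right sum.distrib)
  show "ce_diff m k (c *\<^sub>R \<omega>) = c *\<^sub>R ce_diff m k \<omega>"
    by (auto simp: ce_diff_def fun_eq_iff scaleR_fun_def linear_cmul[OF assms] scaleR_add_right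
        scaleR_sum_right mult_ac)
qed

lemma cochains_linearD:
  "\<omega> \<in> cochains k \<Longrightarrow> length xs = k \<Longrightarrow> i < k \<Longrightarrow> linear (\<lambda>v. \<omega> (xs[i := v]))"
  unfolding cochains_def mem_Collect_eq by (elim conjE) simp

lemma cochains_alternatingD:
  "\<omega> \<in> cochains k \<Longrightarrow> length xs = k \<Longrightarrow> i < j \<Longrightarrow> j < k \<Longrightarrow> xs ! i = xs ! j \<Longrightarrow> \<omega> xs = 0"
  unfolding cochains_def mem_Collect_eq by (elim conjE) blast

lemma cochains_lengthD: "\<omega> \<in> cochains k \<Longrightarrow> length xs \<noteq> k \<Longrightarrow> \<omega> xs = 0"
  unfolding cochains_def by simp

text \<open>Lists of the wrong length give the zero map, so linearity in the head can be used inside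
  the sums of \<open>ce_diff\<close> without a length condition.\<close>

lemma linear_cochain_Cons:
  assumes "\<omega> \<in> cochains (Suc k)"
  shows "linear (\<lambda>v. \<omega> (v # xs))"
proof (cases "length xs = k")
  case True
  then have "linear (\<lambda>v. \<omega> ((0 # xs)[0 := v]))"
    by (intro cochains_linearD[OF assms]) auto
  then show ?thesis
    by simp
next
  case False
  then have "(\<lambda>v. \<omega> (v # xs)) = (\<lambda>_. 0)"
    using cochains_lengthD[OF assms] by (simp add: fun_eq_iff)
  then show ?thesis
    by (simp add: module_hom_zero)
qed

text \<open>The bracket enters each summand once, either outside \<open>\<omega>\<close> or in its
  first slot. This makes the graded Jacobi identity a linear condition in the perturbation of the
  bracket.\<close>

lemma linear_ce_diff_bracket:
  assumes "\<omega> \<in> cochains (Suc k)"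
  shows "linear (\<lambda>b. ce_diff (skew_apply b) (Suc k) \<omega>)"
proof (rule linearI)
  note lin = linear_cochain_Cons[OF assms]
  fix a b :: "'a skew_bilinear" and c
  show "ce_diff (skew_apply (a + b)) (Suc k) \<omega>
      = ce_diff (skew_apply a) (Suc k) \<omega> + ce_diff (skew_apply b) (Suc k) \<omega>"
    by (auto simp: ce_diff_def fun_eq_iff skew_apply_plus linear_add[OF lin] scaleR_add_right
        sum.distrib simp del: sum.atMost_Suc)
  show "ce_diff (skew_apply (c *\<^sub>R a)) (Suc k) \<omega> = c *\<^sub>R ce_diff (skew_apply a) (Suc k) \<omega>"
    by (auto simp: ce_diff_def fun_eq_iff scaleR_fun_def skew_apply_scaleR linear_cmul[OF lin]
        scaleR_add_right scaleR_sum_right mult_ac simp del: sum.atMost_Suc)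
qed

lemma subspace_cochains: "subspace (cochains k)"
proof -
  have "linear (\<lambda>v. (0 :: 'a list \<Rightarrow> 'a) (xs[i := v]))" for xs :: "'a::real_vector list" and i
    by (simp add: module_hom_zero)
  then show ?thesis
    by (auto simp: subspace_def cochains_def scaleR_fun_def
        intro!: linear_compose_add linear_compose_scale_right)
qed

lemma cochain_eq_0I:
  fixes \<omega> :: "'a::real_vector list \<Rightarrow> 'a"
  assumes \<omega>: "\<omega> \<in> cochains k" and B: "span B = UNIV"
    and 0: "\<And>xs. length xs = k \<Longrightarrow> set xs \<subseteq> B \<Longrightarrow> \<omega> xs = 0"
  shows "\<omega> = 0"
proof
  \<comment> \<open>The first \<open>j\<close> arguments are arbitrary and the rest lie in
    \<open>B\<close>; each induction step frees one more slot by linearity, until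
    \<open>j = k\<close>.\<close>
  have *: "\<omega> xs = 0" if "length xs = k" "j \<le> k" "set (drop j xs) \<subseteq> B" for j xs
    using that
  proof (induction j arbitrary: xs)
    case 0
    then show ?case
      using assms(3) by simp
  next
    case (Suc j)
    have lin: "linear (\<lambda>v. \<omega> (xs[j := v]))"
      using Suc.prems by (intro cochains_linearD[OF \<omega>]) auto
    have "\<omega> (xs[j := b]) = 0" if "b \<in> B" for b
    proof (rule Suc.IH)
      have "drop j (xs[j := b]) = b # drop (Suc j) xs"
        using Suc.prems by (metis Cons_nth_drop_Suc Suc_le_lessD drop_update_cancel length_list_update
            lessI nth_list_update_eq)
      then show "set (drop j (xs[j := b])) \<subseteq> B"
        using Suc.prems that by simp
    qed (use Suc.prems in auto)
    then have "\<omega> (xs[j := xs ! j]) = 0"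
      using linear_eq_0_on_span[OF lin, of B "xs ! j"] B by blast
    then show ?case
      by simp
  qed
  fix xs
  show "\<omega> xs = 0 xs"
    using *[of xs k] cochains_lengthD[OF \<omega>, of xs] by (cases "length xs = k") auto
qed

lemma scaleR_fun_apply: "(c *\<^sub>R f) x = c *\<^sub>R f x"
  by (simp add: scaleR_fun_def)

lemma sum_fun_apply: "(\<Sum>i\<in>I. f i) x = (\<Sum>i\<in>I. f i x)"
  by (induction I rule: infinite_finite_induct) auto

text \<open>A cochain is determined by its values on the finite set \<open>T\<close> of tuples from
  a spanning set. Restriction to \<open>T\<close> is thus injective into a finitely generated space,
  and a linear left inverse carries generators back.\<close>

lemma cochains_finite_dim:
  assumes fd: "\<exists>B :: 'a::real_vector set. finite B \<and> span B = UNIV"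
  obtains F :: "('a::real_vector list \<Rightarrow> 'a) set"
  where "finite F" "independent F" "span F = cochains k"
proof -
  obtain B :: "'a set" where B: "finite B" "span B = UNIV"
    using fd by blast
  define T where "T = {xs. set xs \<subseteq> B \<and> length xs = k}"
  have "finite T"
    unfolding T_def using B(1) by (rule finite_lists_length_eq)
  define D where "D xs y = (\<lambda>zs. if zs = xs then y else 0)" for xs :: "'a list" and y :: 'a
  have D_lin: "linear (D xs)" for xs
    by (rule linearI) (auto simp: D_def fun_eq_iff scaleR_fun_def)
  define E where "E = (\<Union>xs\<in>T. D xs ` B)"
  \<comment> \<open>\<open>R \<omega>\<close> is \<open>\<omega>\<close> cut off outside
    \<open>T\<close>, which need not be a cochain.\<close>
  define R where "R \<omega> = (\<Sum>xs\<in>T. D xs (\<omega> xs))" for \<omega> :: "'a list \<Rightarrow> 'a"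
  have R_span: "R \<omega> \<in> span E" for \<omega>
    unfolding R_def
  proof (rule span_sum)
    fix xs assume "xs \<in> T"
    have "D xs (\<omega> xs) \<in> span (D xs ` B)"
      using linear_span_image[OF D_lin] B(2) by blast
    then show "D xs (\<omega> xs) \<in> span E"
      using span_mono[of "D xs ` B" E] \<open>xs \<in> T\<close> unfolding E_def by blast
  qed
  have R_lin: "linear R"
    by (rule linearI) (simp_all add: R_def linear_add[OF D_lin] linear_cmul[OF D_lin] sum.distrib
        scaleR_sum_right scaleR_fun_apply)
  have R_apply: "R \<omega> xs = \<omega> xs" if "xs \<in> T" for \<omega> xs
    using that \<open>finite T\<close> by (simp add: R_def sum_fun_apply D_def)
  have "inj_on R (cochains k)"
  proof (rule inj_onI)
    fix \<omega> \<eta> assume *: "\<omega> \<in> cochains k" "\<eta> \<in> cochains k" "R \<omega> = R \<eta>"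
    have "\<omega> - \<eta> = 0"
    proof (rule cochain_eq_0I[OF _ B(2)])
      show "\<omega> - \<eta> \<in> cochains k"
        using * subspace_cochains subspace_diff by blast
      show "(\<omega> - \<eta>) xs = 0" if "length xs = k" "set xs \<subseteq> B" for xs
        using R_apply[of xs \<omega>] R_apply[of xs \<eta>] * that by (simp add: T_def)
    qed
    then show "\<omega> = \<eta>"
      by simp
  qed
  then obtain g where g: "linear g" "\<forall>\<omega>\<in>cochains k. g (R \<omega>) = \<omega>"
    using linear_exists_left_inverse_on[OF R_lin subspace_cochains] by blast
  have "cochains k \<subseteq> span (g ` E)"
  proof
    fix \<omega> :: "'a list \<Rightarrow> 'a" assume "\<omega> \<in> cochains k"
    then have "\<omega> \<in> g ` span E"
      using g(2) R_span by (metis image_eqI)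
    then show "\<omega> \<in> span (g ` E)"
      by (simp add: linear_span_image[OF g(1)])
  qed
  moreover have "finite (g ` E)"
    unfolding E_def using \<open>finite T\<close> B(1) by auto
  ultimately show ?thesis
    using that finite_span_basis subspace_cochains by metis
qed

lemma range_cochain_of:
  assumes fd: "\<exists>B :: 'a::real_normed_vector set. finite B \<and> span B = UNIV"
  shows "range cochain_of = (cochains 2 :: ('a::real_normed_vector list \<Rightarrow> 'a) set)"
proof (intro equalityI subsetI)
  fix \<omega> :: "'a list \<Rightarrow> 'a" assume "\<omega> \<in> range cochain_of"
  then obtain b where \<omega>: "\<omega> = cochain_of b"
    by blast
  have "linear (\<lambda>v. cochain_of b (xs[i := v]))" if "length xs = 2" "i < 2" for xs i
  proof -
    have "i = 0 \<or> i = 1"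
      using \<open>i < 2\<close> by auto
    then show ?thesis
      using that(1) by (auto simp: cochain_of_def skew_apply_bilinear_simps intro!: linearI)
  qed
  moreover have "cochain_of b xs = 0" if "length xs = 2" "i < j" "j < 2" "xs ! i = xs ! j" for xs i j
  proof -
    have "i = 0" "j = 1"
      using that by auto
    then have "xs ! 1 = xs ! 0"
      using that(4) by simp
    then show ?thesis
      by (simp add: cochain_of_def)
  qed
  ultimately show "\<omega> \<in> cochains 2"
    unfolding \<omega> by (auto simp: cochains_def cochain_of_def)
next
  fix \<omega> :: "'a list \<Rightarrow> 'a" assume \<omega>: "\<omega> \<in> cochains 2"
  define f where "f x y = \<omega> [x, y]" for x y
  have lin: "linear (\<lambda>v. \<omega> (xs[i := v]))" if "length xs = 2" "i < 2" for xs i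
    using that by (rule cochains_linearD[OF \<omega>])
  have lin1: "linear (\<lambda>x. f x y)" for y
    using lin[of "[0, y]" 0] by (simp add: f_def)
  have lin2: "linear (f x)" for x
    using lin[of "[x, 0]" 1] by (simp add: f_def[abs_def])
  have alt: "f x x = 0" for x
    unfolding f_def using cochains_alternatingD[OF \<omega>, of "[x, x]" 0 1] by simp
  have "f x y = - f y x" for x y
  proof -
    \<comment> \<open>Polarization turns the alternating condition into skew-symmetry.\<close>
    have "f (x + y) (x + y) = (f x x + f x y) + (f y x + f y y)"
      by (simp only: linear_add[OF lin1] linear_add[OF lin2] add_ac)
    then have "f x y + f y x = 0"
      by (simp only: alt add_0_left add_0_right)
    then show ?thesis
      by (simp only: eq_neg_iff_add_eq_0)
  qed
  moreover have "bilinear f"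
    using lin1 lin2 by (simp add: bilinear_def)
  ultimately obtain b where b: "skew_apply b = f"
    using skew_bilinear_exhaust[OF fd] by blast
  have "\<omega> = cochain_of b"
  proof
    fix xs
    show "\<omega> xs = cochain_of b xs"
    proof (cases "length xs = 2")
      case True
      then obtain x y where "xs = [x, y]"
        by (auto simp: length_Suc_conv numeral_2_eq_2)
      then show ?thesis
        by (simp add: cochain_of_def b f_def)
    next
      case False
      then show ?thesis
        using cochains_lengthD[OF \<omega>] by (simp add: cochain_of_def)
    qed
  qed
  then show "\<omega> \<in> range cochain_of"
    by blast
qed

text \<open>Makes boundedness and completeness available on the space of brackets itself.\<close>

lemma finite_dim_skew_bilinear:
  assumes fd: "\<exists>B :: 'a::real_normed_vector set. finite B \<and> span B = UNIV"
  shows "\<exists>B :: 'a::real_normed_vector skew_bilinear set. finite B \<and> span B = UNIV"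
proof -
  obtain F :: "('a list \<Rightarrow> 'a) set" where F: "finite F" "span F = cochains 2"
    using cochains_finite_dim[OF fd] by metis
  obtain h :: "('a list \<Rightarrow> 'a) \<Rightarrow> 'a skew_bilinear" where h: "linear h" "h \<circ> cochain_of = id"
    using linear_injective_left_inverse[OF linear_cochain_of inj_cochain_of] by blast
  have "span (h ` F) = h ` range cochain_of"
    by (simp add: linear_span_image[OF h(1)] F(2) range_cochain_of[OF fd])
  also have "\<dots> = UNIV"
    by (simp add: image_comp h(2))
  finally show ?thesis
    using F(1) by blast
qed

section \<open>Consequences of the vanishing of the third cohomology\<close>

lemma linear_ce_diff_skew: "linear (ce_diff (skew_apply b) k)"
  using bilinear_skew_apply[of b] by (intro linear_ce_diff) (simp add: bilinear_def)

text \<open>The class of \<open>\<omega>\<close> contains \<open>\<omega>\<close> because 0 is a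
  coboundary, and it must equal the only class, the set of coboundaries.\<close>

lemma cohomology_3_trivialD:
  assumes H3: "cohomology (skew_apply \<mu>) 3 = {coboundaries (skew_apply \<mu>) 3}"
    and \<omega>: "\<omega> \<in> cocycles (skew_apply \<mu>) 3"
  shows "\<omega> \<in> ce_diff (skew_apply \<mu>) 2 ` cochains 2"
proof -
  let ?R = "{(\<omega>, \<eta>). \<omega> - \<eta> \<in> coboundaries (skew_apply \<mu>) 3}"
  have cob: "coboundaries (skew_apply \<mu>) 3 = ce_diff (skew_apply \<mu>) 2 ` cochains 2"
    by (simp add: coboundaries_def numeral_3_eq_3 numeral_2_eq_2)
  have "0 \<in> coboundaries (skew_apply \<mu>) 3"
    unfolding cob using linear_0[OF linear_ce_diff_skew] subspace_0[OF subspace_cochains]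
    by (metis image_eqI)
  then have "\<omega> \<in> ?R `` {\<omega>}"
    by simp
  moreover have "?R `` {\<omega>} \<in> cohomology (skew_apply \<mu>) 3"
    unfolding cohomology_def using \<omega> by (rule quotientI)
  ultimately show ?thesis
    using H3 cob by blast
qed

text \<open>With \<open>\<delta>\<close> the differential of \<open>\<mu>\<close>, the projection \<open>P = \<delta> \<circ> \<sigma>\<close> onto the coboundaries fixes every
  cocycle, so that \<open>P \<omega> = 0\<close> recovers \<open>\<omega>\<close> from \<open>\<delta> \<omega>\<close>. For \<open>\<omega>\<close> the Jacobiator of \<open>\<mu> + a\<close>, the
  graded Jacobi identity says that \<open>- \<delta> \<omega>\<close> is linear in \<open>a\<close>, which makes \<open>\<omega>\<close> a fixed point of a
  linear map of size \<open>O(a)\<close>.\<close>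

lemma jacobiator_eq_0_if_projection_eq_0:
  fixes \<mu> :: "'a::real_normed_vector skew_bilinear"
  assumes fd: "\<exists>B :: 'a set. finite B \<and> span B = UNIV"
    and H3: "cohomology (skew_apply \<mu>) 3 = {coboundaries (skew_apply \<mu>) 3}"
    and \<sigma>: "linear \<sigma>" "\<And>\<eta>. \<eta> \<in> ce_diff (skew_apply \<mu>) 2 ` cochains 2 \<Longrightarrow> ce_diff (skew_apply \<mu>) 2 (\<sigma> \<eta>) = \<eta>"
  obtains e where "e > 0"
    "\<And>a. norm a < e \<Longrightarrow> ce_diff (skew_apply \<mu>) 2 (\<sigma> (jacobiator (\<mu> + a) (\<mu> + a))) = 0 \<Longrightarrow>
      jacobiator (\<mu> + a) (\<mu> + a) = 0"
proof -
  define d3 where "d3 = ce_diff (skew_apply \<mu>) 3"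
  define P where "P = ce_diff (skew_apply \<mu>) 2 \<circ> \<sigma>"
  obtain F :: "('a list \<Rightarrow> 'a) set" where F: "finite F" "independent F" "span F = cochains 3"
    using cochains_finite_dim[OF fd] by metis
  have lin_d3: "linear d3"
    unfolding d3_def by (rule linear_ce_diff_skew)
  have lin_P: "linear P"
    unfolding P_def using \<sigma>(1) linear_ce_diff_skew by (rule linear_compose)
  obtain \<rho> where \<rho>: "linear \<rho>" "range \<rho> \<subseteq> cochains 3" "\<And>\<eta>. \<eta> \<in> d3 ` cochains 3 \<Longrightarrow> d3 (\<rho> \<eta>) = \<eta>"
    using linear_exists_right_inverse_on[OF lin_d3 subspace_cochains] by blast
  \<comment> \<open>When \<open>P \<omega> = 0\<close>, applying \<open>P\<close> to the cocycle
    \<open>\<omega> - \<rho> (d3 \<omega>)\<close> gives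
    \<open>\<omega> = - \<tau> (d3 \<omega>)\<close>. The graded Jacobi identity replaces
    \<open>- d3 \<omega>\<close> by the differential of \<open>a\<close>, whence
    \<open>\<omega> = T a \<omega>\<close>.\<close>
  define \<tau> where "\<tau> \<eta> = P (\<rho> \<eta>) - \<rho> \<eta>" for \<eta>
  have lin_\<tau>: "linear \<tau>"
    unfolding \<tau>_def
    by (intro linear_compose_sub \<rho>(1) linear_compose[OF \<rho>(1) lin_P, unfolded o_def])
  define T where "T a \<omega> = \<tau> (ce_diff (skew_apply a) 3 \<omega>)" for a \<omega>
  have lin_E: "linear (\<lambda>a. ce_diff (skew_apply a) 3 \<omega>)" if "\<omega> \<in> cochains 3" for \<omega> :: "'a list \<Rightarrow> 'a"
    using linear_ce_diff_bracket[of \<omega> 2] that by simp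
  have "linear (T a)" for a
    unfolding T_def using linear_compose[OF linear_ce_diff_skew lin_\<tau>] by (simp add: o_def)
  moreover have "linear (\<lambda>a. T a \<omega>)" if "\<omega> \<in> span F" for \<omega>
    unfolding T_def using linear_compose[OF lin_E lin_\<tau>, of \<omega>] that F(3) by (simp add: o_def)
  ultimately obtain e where e: "e > 0"
    "\<And>a \<omega>. norm a < e \<Longrightarrow> \<omega> \<in> span F \<Longrightarrow> T a \<omega> = \<omega> \<Longrightarrow> \<omega> = 0"
    using small_perturbation_no_fixed_point[OF finite_dim_skew_bilinear[OF fd] F(1,2)] by metis
  show ?thesis
  proof (rule that[OF e(1)])
    fix a :: "'a skew_bilinear"
    define \<omega> where "\<omega> = jacobiator (\<mu> + a) (\<mu> + a)"
    assume a: "norm a < e" "ce_diff (skew_apply \<mu>) 2 (\<sigma> (jacobiator (\<mu> + a) (\<mu> + a))) = 0"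
    then have P\<omega>: "P \<omega> = 0"
      by (simp add: P_def \<omega>_def)
    have \<omega>: "\<omega> \<in> cochains 3"
      unfolding \<omega>_def by (rule jacobiator_cochain)
    have "d3 \<omega> + ce_diff (skew_apply a) 3 \<omega> = ce_diff (skew_apply (\<mu> + a)) 3 \<omega>"
      using linear_add[OF lin_E[OF \<omega>], of \<mu> a] by (simp add: d3_def)
    also have "\<dots> = 0"
      unfolding \<omega>_def by (rule ce_diff_jacobiator)
    finally have E: "ce_diff (skew_apply a) 3 \<omega> = - d3 \<omega>"
      by (simp only: eq_neg_iff_add_eq_0 add.commute)
    define \<zeta> where "\<zeta> = \<omega> - \<rho> (d3 \<omega>)"
    have "\<zeta> \<in> cochains 3"
      unfolding \<zeta>_def using \<omega> \<rho>(2) by (intro subspace_diff subspace_cochains) auto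
    moreover have "d3 \<zeta> = 0"
      unfolding \<zeta>_def using \<omega> \<rho>(3) by (simp add: linear_diff[OF lin_d3])
    ultimately have "\<zeta> \<in> ce_diff (skew_apply \<mu>) 2 ` cochains 2"
      by (intro cohomology_3_trivialD[OF H3]) (simp add: cocycles_def d3_def)
    then have "P \<zeta> = \<zeta>"
      using \<sigma>(2) by (simp add: P_def)
    then have "\<omega> = \<rho> (d3 \<omega>) - P (\<rho> (d3 \<omega>))"
      using P\<omega> by (simp add: \<zeta>_def linear_diff[OF lin_P] algebra_simps)
    also have "\<dots> = T a \<omega>"
      by (simp add: T_def E \<tau>_def linear_neg[OF \<rho>(1)] linear_neg[OF lin_P])
    finally have "\<omega> = 0"
      using e(2)[OF a(1), of \<omega>] \<omega> F(3) by simp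
    then show "jacobiator (\<mu> + a) (\<mu> + a) = 0"
      by (simp add: \<omega>_def)
  qed
qed

section \<open>The slice chart for the Lie algebra structures\<close>

theorem theorem5p4:
  fixes \<mu> :: "'a::real_normed_vector skew_bilinear"
  assumes finite_dim: "\<exists>B :: 'a set. finite B \<and> span B = UNIV"
    and lie: "\<mu> \<in> lie_structures"
    and H3: "cohomology (skew_apply \<mu>) 3 = {coboundaries (skew_apply \<mu>) 3}"
  shows "\<exists>N. open N \<and> \<mu> \<in> N \<and>
           smooth_submanifold (dim (cocycles (skew_apply \<mu>) 2)) (N \<inter> lie_structures)"
proof -
  define d2 where "d2 = ce_diff (skew_apply \<mu>) 2"
  have lin_d2: "linear d2"
    unfolding d2_def by (rule linear_ce_diff_skew)
  note range = range_cochain_of[OF finite_dim]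
  note fd = finite_dim_skew_bilinear[OF finite_dim]
  obtain \<sigma> where \<sigma>: "linear \<sigma>" "range \<sigma> \<subseteq> cochains 2" "\<And>\<eta>. \<eta> \<in> d2 ` cochains 2 \<Longrightarrow> d2 (\<sigma> \<eta>) = \<eta>"
    using linear_exists_right_inverse_on[OF lin_d2 subspace_cochains] by blast
  \<comment> \<open>\<open>h\<close> turns 2-cochains back into brackets; by finite dimension it is
    a two-sided inverse of \<open>cochain_of\<close> on \<open>cochains 2\<close>.\<close>
  obtain h :: "('a list \<Rightarrow> 'a) \<Rightarrow> 'a skew_bilinear" where h: "linear h" "h \<circ> cochain_of = id"
    using linear_injective_left_inverse[OF linear_cochain_of inj_cochain_of] by blast
  have h': "cochain_of (h \<omega>) = \<omega>" if "\<omega> \<in> cochains 2" for \<omega>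
    using that h(2) unfolding range[symmetric] by (auto simp: fun_eq_iff)
  obtain e where e: "e > 0"
    "\<And>a. norm a < e \<Longrightarrow> d2 (\<sigma> (jacobiator (\<mu> + a) (\<mu> + a))) = 0 \<Longrightarrow> jacobiator (\<mu> + a) (\<mu> + a) = 0"
    using jacobiator_eq_0_if_projection_eq_0[OF finite_dim H3 \<sigma>(1)] \<sigma>(3) unfolding d2_def by metis

  define \<beta> where "\<beta> a c = h (\<sigma> (jacobiator a c))" for a c
  have "bilinear \<beta>"
  proof -
    have lin: "linear (\<lambda>\<eta>. h (\<sigma> \<eta>))"
      using linear_compose[OF \<sigma>(1) h(1)] by (simp add: o_def)
    show ?thesis
      using bilinear_jacobiator linear_compose[OF _ lin, unfolded o_def]
      unfolding bilinear_def \<beta>_def by blast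
  qed
  then have "bounded_bilinear \<beta>"
    by (rule bilinear_imp_bounded_bilinear[OF fd fd])
  then obtain K where K: "K \<ge> 0" "\<And>x y. norm (\<beta> x y) \<le> norm x * norm y * K"
    using bounded_bilinear.nonneg_bounded by blast
  \<comment> \<open>The bound \<open>e\<close> keeps the Jacobiator criterion available on
    \<open>U\<close>; the other bound gives \<open>4 * (K * r) \<le> 1\<close>, with
    \<open>K + 1\<close> in place of \<open>K\<close> to allow \<open>K = 0\<close>.\<close>
  define r where "r = min e (1 / (4 * (K + 1)))"
  have "K * r \<le> K * (1 / (4 * (K + 1)))"
    unfolding r_def using K(1) by (intro mult_left_mono) auto
  also have "\<dots> \<le> 1 / 4"
    using K(1) by (simp add: field_simps)
  finally have "4 * (K * r) \<le> 1"
    by simp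
  moreover have "0 < r"
    using e(1) K(1) by (simp add: r_def)
  ultimately interpret quadratic_perturbation \<beta> \<mu> K r
    using K \<open>bounded_bilinear \<beta>\<close> finite_dim_complete_UNIV[OF fd]
    by (intro quadratic_perturbation.intro)

  define Z where "Z = {a. cochain_of a \<in> cocycles (skew_apply \<mu>) 2}"
  have lie_iff: "b \<in> lie_structures \<longleftrightarrow> \<phi> b \<in> Z" if "b \<in> U" for b
  proof -
    define a where "a = b - \<mu>"
    have b: "b = \<mu> + a"
      by (simp add: a_def)
    have "norm a < r"
      using that by (simp add: U_def a_def dist_norm norm_minus_commute)
    also have "r \<le> e"
      by (simp add: r_def)
    finally have "norm a < e" .
    \<comment> \<open>The constant term of the expansion vanishes because \<open>\<mu>\<close> is a
      Lie bracket.\<close>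
    have "jacobiator b b = d2 (cochain_of a) + jacobiator a a"
      using lie by (simp add: b d2_def ce_diff_cochain_of lie_structures_iff
          bilinear_ladd[OF bilinear_jacobiator] bilinear_radd[OF bilinear_jacobiator] add_ac)
    moreover have "d2 (\<sigma> (d2 (cochain_of a))) = d2 (cochain_of a)"
      using \<sigma>(3) range by blast
    moreover have "cochain_of (\<phi> b) = cochain_of a + \<sigma> (jacobiator a a)"
      using \<sigma>(2) h' by (simp add: \<phi>_def \<beta>_def a_def linear_add[OF linear_cochain_of] image_subset_iff)
    \<comment> \<open>Since \<open>d2 (\<sigma> (d2 (cochain_of a))) = d2 (cochain_of a)\<close>,
      both summands of \<open>cochain_of (\<phi> b)\<close> combine to
      \<open>d2 (\<sigma> (jacobiator b b))\<close>.\<close>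
    ultimately have "d2 (cochain_of (\<phi> b)) = d2 (\<sigma> (jacobiator b b))"
      by (simp add: linear_add[OF lin_d2] linear_add[OF \<sigma>(1)])
    moreover have "\<phi> b \<in> Z \<longleftrightarrow> d2 (cochain_of (\<phi> b)) = 0"
      using range by (auto simp: Z_def cocycles_def d2_def)
    ultimately show ?thesis
      using e(2)[OF \<open>norm a < e\<close>] linear_0[OF \<sigma>(1)] linear_0[OF lin_d2]
      by (auto simp: lie_structures_iff b)
  qed

  obtain F :: "('a list \<Rightarrow> 'a) set" where F: "finite F" "span F = cochains 2"
    using cochains_finite_dim[OF finite_dim] by metis
  have "subspace (cocycles (skew_apply \<mu>) 2)"
    using subspace_inter[OF subspace_cochains linear_subspace_kernel[OF lin_d2]]
    by (simp add: cocycles_def d2_def Int_def)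
  then obtain C where C: "finite C" "independent C" "span C = cocycles (skew_apply \<mu>) 2"
    "card C = dim (cocycles (skew_apply \<mu>) 2)"
    using finite_span_basis[OF F(1)] F(2) by (metis (no_types, lifting) cocycles_def mem_Collect_eq subsetI)
  \<comment> \<open>Cocycles are 2-cochains, where \<open>h\<close> is invertible; so
    \<open>h\<close> carries the basis \<open>C\<close> to a basis of \<open>Z\<close> with the same
    number of elements.\<close>
  have inj: "inj_on h (span C)"
    using h' C(3) by (metis (no_types, lifting) cocycles_def inj_on_def mem_Collect_eq)
  have "span (h ` C) = Z"
  proof -
    have "h ` span C = Z"
    proof (intro equalityI subsetI)
      fix a assume "a \<in> h ` span C"
      then show "a \<in> Z"
        unfolding C(3) by (auto simp: Z_def cocycles_def h')
    next
      fix a assume "a \<in> Z"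
      moreover have "h (cochain_of a) = a"
        using h(2) by (simp add: pointfree_idE)
      ultimately show "a \<in> h ` span C"
        unfolding C(3) Z_def by (metis image_eqI mem_Collect_eq)
    qed
    then show ?thesis
      by (simp add: linear_span_image[OF h(1)])
  qed
  moreover have "independent (h ` C)" "card (h ` C) = dim (cocycles (skew_apply \<mu>) 2)"
    using linear_independent_injective_image[OF h(1) C(2) inj] C(4)
      card_image[OF inj_on_subset[OF inj span_superset]] by simp_all
  moreover have "\<phi> ` (U \<inter> (U \<inter> lie_structures)) = W \<inter> Z"
  proof -
    have "\<phi> ` (U \<inter> (U \<inter> lie_structures)) = \<phi> ` (U \<inter> \<phi> -` Z)"
      using lie_iff by (intro arg_cong[of _ _ "image \<phi>"]) auto
    also have "\<dots> = \<phi> ` U \<inter> Z"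
      by blast
    also have "\<phi> ` U = W"
      using homeomorphism_\<phi> by (simp add: homeomorphism_def)
    finally show ?thesis .
  qed
  \<comment> \<open>The one chart \<open>\<phi>\<close> on \<open>U\<close> serves all points, and
    \<open>U\<close> itself is the neighborhood of \<open>\<mu>\<close>.\<close>
  ultimately have "smooth_submanifold (dim (cocycles (skew_apply \<mu>) 2)) (U \<inter> lie_structures)"
    unfolding smooth_submanifold_def
    using open_U open_W homeomorphism_\<phi> smooth_\<phi> smooth_\<psi> finite_imageI[OF C(1), of h]
    by (intro ballI exI[of _ U] exI[of _ W] exI[of _ \<phi>] exI[of _ \<psi>] exI[of _ "h ` C"]) simp
  then show ?thesis
    using open_U p_mem_U by blast
qed

end
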